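(* Let $(M,\mathbf g)$ be a $4$-dimensional static spherically symmetric space-time with metric locally of the form $$\mathbf g=g_{00}(dx^0)^2+2g_{01}\,dx^0dx^1+g_{11}(dx^1)^2+g_{\theta\theta}\,(d\theta^2+\sin^2\theta\,d\phi^2)$$ in coordinates $(x^0,x^1,\theta,\phi)$ adapted to the spherical symmetry, where $g_{00},g_{01},g_{11},g_{\theta\theta}>0$ depend only on $x^0,x^1$, and $g_{\theta\theta}$ is a function of a scalar $r$ (depending only on $x^0,x^1$) alone. Let $S$ be an $SO(3)\times\mathbb R$-invariant timelike hypersurface of $(M,\mathbf g)$ and suppose that $\nabla r$ is nowhere zero along $S$. Then $S$ is an $SO(3)\times\mathbb R$-invariant photon surface of $(M,\mathbf g)$ if and only if $$2g_{\theta\theta}\,\epsilon^{ab}\epsilon^{cd}r_{;ac}r_{;b}r_{;d}+r^{;a}r_{;a}\,r^{;c}\partial_c g_{\theta\theta}=0$$ holds along $S$.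
   Context: A static spherically symmetric space-time is one admitting an $SO(3)\times\mathbb R$ group of isometries, where the $SO(3)$ orbits are spacelike $2$-spheres and the $\mathbb R$ orbits are generated by a Killing field that is hypersurface orthogonal and orthogonal to the $SO(3)$ orbits. A hypersurface is $G$-invariant if each element of $G$ maps it onto itself. A photon surface of $(M,\mathbf g)$ is an immersed, nowhere-spacelike hypersurface $S$ such that for every $p\in S$ and every null vector $\mathbf k\in T_pS$ there exists a null geodesic $\gamma:(-\epsilon,\epsilon)\to M$ of $(M,\mathbf g)$ with $\dot\gamma(0)=\mathbf k$ and image contained in $S$. The tensor $\epsilon^{ab}$ has, in the coordinate basis above, components $\epsilon^{01}=-\epsilon^{10}=(-\Delta)^{-1/2}$ and all others zero, where $\Delta=g_{00}g_{11}-(g_{01})^2$. Semicolons denote the Levi-Civita covariant derivative of $\mathbf g$, indices raised with $\mathbf g$.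
   Formalization: The scalar r is assumed invariant under the static Killing flow (without this the claim fails, e.g. for constant g_θθ), and M is taken to be one coordinate patch adapted to the symmetry, with invariance stated in that patch; the global case follows by covering M with such patches. *)

theory Defs
  imports "HOL-Analysis.Analysis"
begin

fun Ck :: "nat \<Rightarrow> 'a::euclidean_space set \<Rightarrow> ('a \<Rightarrow> real) \<Rightarrow> bool" where
  "Ck 0 A f = continuous_on A f"
| "Ck (Suc k) A f = (f differentiable_on A \<and>
      (\<forall>b\<in>Basis. Ck k A (\<lambda>x. frechet_derivative f (at x) b)))"

definition smooth_fun :: "'a::euclidean_space set \<Rightarrow> ('a \<Rightarrow> real) \<Rightarrow> bool" where
  "smooth_fun A f \<longleftrightarrow> (\<forall>k. Ck k A f)"

section \<open>Coordinates (x^0,x^1,theta,phi) = (p$1,p$2,p$3,p$4) on real^4\<close>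

definition partial :: "4 \<Rightarrow> (real^4 \<Rightarrow> real) \<Rightarrow> real^4 \<Rightarrow> real" where
  "partial i f p = frechet_derivative f (at p) (axis i 1)"

definition lift2 :: "(real \<times> real \<Rightarrow> real) \<Rightarrow> real^4 \<Rightarrow> real" where
  "lift2 f p = f (p$1, p$2)"

definition chartdom :: "(real \<times> real) set \<Rightarrow> (real^4) set" where
  "chartdom D = {p. (p$1, p$2) \<in> D \<and> 0 < p$3 \<and> p$3 < pi}"

definition sss_metric ::
  "(real \<times> real \<Rightarrow> real) \<Rightarrow> (real \<times> real \<Rightarrow> real) \<Rightarrow> (real \<times> real \<Rightarrow> real) \<Rightarrow>
   (real \<times> real \<Rightarrow> real) \<Rightarrow> real^4 \<Rightarrow> real^4^4" where
  "sss_metric g00 g01 g11 gth p = (\<chi> i. \<chi> j.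
     if i = 1 \<and> j = 1 then lift2 g00 p
     else if (i = 1 \<and> j = 2) \<or> (i = 2 \<and> j = 1) then lift2 g01 p
     else if i = 2 \<and> j = 2 then lift2 g11 p
     else if i = 3 \<and> j = 3 then lift2 gth p
     else if i = 4 \<and> j = 4 then lift2 gth p * (sin (p$3))\<^sup>2
     else 0)"

definition gform :: "(real^4 \<Rightarrow> real^4^4) \<Rightarrow> real^4 \<Rightarrow> real^4 \<Rightarrow> real^4 \<Rightarrow> real" where
  "gform G p v w = (\<Sum>i\<in>UNIV. \<Sum>j\<in>UNIV. G p $ i $ j * v $ i * w $ j)"

definition ginv :: "(real^4 \<Rightarrow> real^4^4) \<Rightarrow> real^4 \<Rightarrow> 4 \<Rightarrow> 4 \<Rightarrow> real" where
  "ginv G p i j = matrix_inv (G p) $ i $ j"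

definition christoffel :: "(real^4 \<Rightarrow> real^4^4) \<Rightarrow> real^4 \<Rightarrow> 4 \<Rightarrow> 4 \<Rightarrow> 4 \<Rightarrow> real" where
  "christoffel G p k i j =
     (\<Sum>l\<in>UNIV. ginv G p k l *
        (partial i (\<lambda>q. G q $ j $ l) p + partial j (\<lambda>q. G q $ i $ l) p
         - partial l (\<lambda>q. G q $ i $ j) p)) / 2"

definition geodesic :: "(real^4 \<Rightarrow> real^4^4) \<Rightarrow> (real^4) set \<Rightarrow> real set \<Rightarrow> (real \<Rightarrow> real^4) \<Rightarrow> bool" where
  "geodesic G U J \<gamma> \<longleftrightarrow>
     (\<exists>\<gamma>' \<gamma>''. \<forall>t\<in>J. \<gamma> t \<in> U \<and>
        (\<gamma> has_vector_derivative \<gamma>' t) (at t) \<and>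
        (\<gamma>' has_vector_derivative \<gamma>'' t) (at t) \<and>
        (\<forall>k. \<gamma>'' t $ k + (\<Sum>i\<in>UNIV. \<Sum>j\<in>UNIV.
              christoffel G (\<gamma> t) k i j * \<gamma>' t $ i * \<gamma>' t $ j) = 0))"

definition immersed_hypersurface :: "(real^4) set \<Rightarrow> (real^3 \<Rightarrow> real^4) \<Rightarrow> (real^3) set \<Rightarrow> bool" where
  "immersed_hypersurface U \<Phi> V \<longleftrightarrow> open V \<and> \<Phi> ` V \<subseteq> U \<and>
     (\<forall>i. smooth_fun V (\<lambda>u. \<Phi> u $ i)) \<and>
     (\<forall>u\<in>V. \<Phi> differentiable (at u) \<and> inj (frechet_derivative \<Phi> (at u)))"

definition tangent_space :: "(real^3 \<Rightarrow> real^4) \<Rightarrow> real^3 \<Rightarrow> (real^4) set" where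
  "tangent_space \<Phi> u = range (frechet_derivative \<Phi> (at u))"

definition timelike_hypersurface ::
  "(real^4 \<Rightarrow> real^4^4) \<Rightarrow> (real^4) set \<Rightarrow> (real^3 \<Rightarrow> real^4) \<Rightarrow> (real^3) set \<Rightarrow> bool" where
  "timelike_hypersurface G U \<Phi> V \<longleftrightarrow> immersed_hypersurface U \<Phi> V \<and>
     (\<forall>u\<in>V. \<exists>v\<in>tangent_space \<Phi> u. gform G (\<Phi> u) v v < 0)"

definition nowhere_spacelike ::
  "(real^4 \<Rightarrow> real^4^4) \<Rightarrow> (real^3 \<Rightarrow> real^4) \<Rightarrow> (real^3) set \<Rightarrow> bool" where
  "nowhere_spacelike G \<Phi> V \<longleftrightarrow>
     (\<forall>u\<in>V. \<exists>v\<in>tangent_space \<Phi> u. v \<noteq> 0 \<and> gform G (\<Phi> u) v v \<le> 0)"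

definition photon_surface ::
  "(real^4 \<Rightarrow> real^4^4) \<Rightarrow> (real^4) set \<Rightarrow> (real^3 \<Rightarrow> real^4) \<Rightarrow> (real^3) set \<Rightarrow> bool" where
  "photon_surface G U \<Phi> V \<longleftrightarrow> immersed_hypersurface U \<Phi> V \<and> nowhere_spacelike G \<Phi> V \<and>
     (\<forall>u\<in>V. \<forall>k\<in>tangent_space \<Phi> u. k \<noteq> 0 \<and> gform G (\<Phi> u) k k = 0 \<longrightarrow>
        (\<exists>\<epsilon>>0. \<exists>\<gamma>. geodesic G U {-\<epsilon><..<\<epsilon>} \<gamma> \<and> \<gamma> 0 = \<Phi> u \<and>
            (\<gamma> has_vector_derivative k) (at 0) \<and> \<gamma> ` {-\<epsilon><..<\<epsilon>} \<subseteq> \<Phi> ` V))"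

definition killing_field :: "(real^4 \<Rightarrow> real^4^4) \<Rightarrow> (real^4) set \<Rightarrow> (real^4 \<Rightarrow> real^4) \<Rightarrow> bool" where
  "killing_field G U X \<longleftrightarrow> (\<forall>p\<in>U. \<forall>i j.
     (\<Sum>k\<in>UNIV. X p $ k * partial k (\<lambda>q. G q $ i $ j) p
        + G p $ k $ j * partial i (\<lambda>q. X q $ k) p
        + G p $ i $ k * partial j (\<lambda>q. X q $ k) p) = 0)"

definition lower :: "(real^4 \<Rightarrow> real^4^4) \<Rightarrow> (real^4 \<Rightarrow> real^4) \<Rightarrow> real^4 \<Rightarrow> 4 \<Rightarrow> real" where
  "lower G X q a = (\<Sum>b\<in>UNIV. G q $ a $ b * X q $ b)"

definition hypersurface_orthogonal :: "(real^4 \<Rightarrow> real^4^4) \<Rightarrow> (real^4) set \<Rightarrow> (real^4 \<Rightarrow> real^4) \<Rightarrow> bool" where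
  "hypersurface_orthogonal G U X \<longleftrightarrow> (\<forall>p\<in>U. \<forall>a b c.
     let Xl = lower G X; d = (\<lambda>i j. partial i (\<lambda>q. Xl q j) p) in
     Xl p a * (d b c - d c b) + Xl p b * (d c a - d a c) + Xl p c * (d a b - d b a) = 0)"

text \<open>Vector field K^0 d_0 + K^1 d_1 (orthogonal to the SO(3) orbits and depending
  only on x^0, x^1, i.e. commuting with SO(3)).\<close>
definition vf2 :: "(real \<times> real \<Rightarrow> real) \<Rightarrow> (real \<times> real \<Rightarrow> real) \<Rightarrow> real^4 \<Rightarrow> real^4" where
  "vf2 K0 K1 p = vector [K0 (p$1, p$2), K1 (p$1, p$2), 0, 0]"

text \<open>SO(3)-invariance in adapted coordinates: membership depends only on (x^0,x^1).\<close>
definition so3_invariant :: "(real^4) set \<Rightarrow> (real^4) set \<Rightarrow> bool" where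
  "so3_invariant U S \<longleftrightarrow> S \<subseteq> U \<and>
     (\<forall>p\<in>U. \<forall>q\<in>U. p$1 = q$1 \<and> p$2 = q$2 \<longrightarrow> (p \<in> S \<longleftrightarrow> q \<in> S))"

definition flow_invariant :: "(real^4 \<Rightarrow> real^4) \<Rightarrow> (real^4) set \<Rightarrow> (real^4) set \<Rightarrow> bool" where
  "flow_invariant X U S \<longleftrightarrow>
     (\<forall>\<sigma> J. is_interval J \<and> 0 \<in> J \<and>
        (\<forall>t\<in>J. \<sigma> t \<in> U \<and> (\<sigma> has_vector_derivative X (\<sigma> t)) (at t within J)) \<and>
        \<sigma> 0 \<in> S \<longrightarrow> (\<forall>t\<in>J. \<sigma> t \<in> S))"

definition eps2 :: "(real^4 \<Rightarrow> real^4^4) \<Rightarrow> real^4 \<Rightarrow> 4 \<Rightarrow> 4 \<Rightarrow> real" where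
  "eps2 G p a b =
     (let \<Delta> = G p $ 1 $ 1 * G p $ 2 $ 2 - (G p $ 1 $ 2)\<^sup>2 in
      if a = 1 \<and> b = 2 then 1 / sqrt (-\<Delta>)
      else if a = 2 \<and> b = 1 then - (1 / sqrt (-\<Delta>)) else 0)"

definition hess :: "(real^4 \<Rightarrow> real^4^4) \<Rightarrow> (real^4 \<Rightarrow> real) \<Rightarrow> real^4 \<Rightarrow> 4 \<Rightarrow> 4 \<Rightarrow> real" where
  "hess G f p a c = partial a (\<lambda>q. partial c f q) p
     - (\<Sum>k\<in>UNIV. christoffel G p k a c * partial k f p)"

definition photon_condition ::
  "(real^4 \<Rightarrow> real^4^4) \<Rightarrow> (real^4 \<Rightarrow> real) \<Rightarrow> (real^4 \<Rightarrow> real) \<Rightarrow> real^4 \<Rightarrow> bool" where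
  "photon_condition G r gth p \<longleftrightarrow>
     2 * gth p * (\<Sum>a\<in>UNIV. \<Sum>b\<in>UNIV. \<Sum>c\<in>UNIV. \<Sum>d\<in>UNIV.
         eps2 G p a b * eps2 G p c d * hess G r p a c * partial b r p * partial d r p)
     + (\<Sum>a\<in>UNIV. \<Sum>b\<in>UNIV. ginv G p a b * partial a r p * partial b r p)
       * (\<Sum>c\<in>UNIV. \<Sum>d\<in>UNIV. ginv G p c d * partial d r p * partial c gth p) = 0"

definition gradient :: "(real^4 \<Rightarrow> real^4^4) \<Rightarrow> (real^4 \<Rightarrow> real) \<Rightarrow> real^4 \<Rightarrow> real^4" where
  "gradient G f p = (\<chi> a. \<Sum>b\<in>UNIV. ginv G p a b * partial b f p)"

end

theory Submission
  imports Defs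
begin

text \<open>
  Since \<^term>\<open>r\<close> is invariant under the static flow and \<open>dr \<noteq> 0\<close>, near a point of the
  hypersurface \<open>S\<close> the level sets of \<^term>\<open>r\<close> are orbits of the flow. An invariant \<open>S\<close> is a
  union of such level sets, so if \<^term>\<open>r\<close> were not locally constant along \<open>S\<close>, then \<open>S\<close>
  would contain an open set; but it is the smooth image of a 3-dimensional set, hence null.
  Thus \<open>T S = ker dr\<close>.

  The vector \<open>T\<^sup>a = \<epsilon>\<^sup>a\<^sup>b r\<^sub>;\<^sub>b\<close> spans the static direction of \<open>T S\<close> and
  \<open>g(T,T) = -|\<nabla>r|\<^sup>2\<close>. For an angular vector \<open>w\<close> making \<open>k = T + w\<close> null, the photon condition is
  exactly \<open>2 g\<^sub>\<theta>\<^sub>\<theta> Hess r (k,k) = 0\<close>. If a null geodesic with velocity \<open>k\<close> stays in \<open>S\<close>,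
  then \<^term>\<open>r\<close> is constant along it and \<open>Hess r (k,k) = 0\<close>.

  Conversely, move along an orbit of the flow with constant parameter speed and along a great
  circle of the sphere. The acceleration \<open>W\<close> of this curve has no angular part, it satisfies
  \<open>dr(W) = 0\<close> because \<open>Hess r (k,k) = 0\<close>, and it is orthogonal to the Killing field \<open>K\<close> because
  \<open>g(K,K)\<close> is constant along the orbits. As \<open>K\<close> is timelike on \<open>S\<close>, \<open>W = 0\<close>.
\<close>

subsection \<open>Integral curves and level sets in the plane\<close>

text \<open>Separation of variables: elapsed time as a function of position is the antiderivative
  \<open>F\<close> of \<open>1/f\<close> normalised at \<open>x1\<close>. It is strictly increasing
  because \<open>f\<close> is positive, and the solution is its inverse. Taking \<open>J\<close> to
  be the whole image of \<open>F\<close> makes the solution sweep the entire interval.\<close>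

lemma scalar_autonomous_ode_exists:
  fixes f :: "real \<Rightarrow> real" and a b x1 :: real
  assumes cont: "continuous_on {a<..<b} f" and pos: "\<And>x. x \<in> {a<..<b} \<Longrightarrow> f x > 0"
    and x1: "x1 \<in> {a<..<b}"
  obtains J X where "open J" "is_interval J" "0 \<in> J" "X 0 = x1" "X ` J = {a<..<b}"
    "\<And>t. t \<in> J \<Longrightarrow> (X has_real_derivative f (X t)) (at t)"
proof -
  let ?I = "{a<..<b}"
  have isC: "isCont (\<lambda>x. inverse (f x)) x" if "ereal a < ereal x" "ereal x < ereal b" for x
  proof -
    have "x \<in> ?I" using that by auto
    then have "isCont f x" "f x \<noteq> 0"
      using cont pos[of x] by (auto simp: continuous_on_eq_continuous_at)
    then show ?thesis by (intro continuous_intros)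
  qed
  have "ereal a < ereal b" using x1 by auto
  from einterval_antiderivative[OF this, of "\<lambda>x. inverse (f x)"] isC
  obtain F0 where F0: "\<And>x. x \<in> ?I \<Longrightarrow> (F0 has_vector_derivative inverse (f x)) (at x)"
    by (auto simp del: ereal_less_eq)
  \<comment> \<open>The shift places time 0 at the position \<open>x1\<close>.\<close>
  define F where "F = (\<lambda>x. F0 x - F0 x1)"
  have F: "(F has_real_derivative inverse (f x)) (at x)" if "x \<in> ?I" for x
    using F0[OF that] unfolding F_def has_real_derivative_iff_has_vector_derivative
    by (auto intro!: derivative_eq_intros)
  have less: "F x < F y" if "x \<in> ?I" "y \<in> ?I" "x < y" for x y
  proof (rule DERIV_pos_imp_increasing[OF that(3)])
    fix z assume "x \<le> z" "z \<le> y"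
    then have "z \<in> ?I" using that by auto
    then show "\<exists>d. (F has_real_derivative d) (at z) \<and> 0 < d"
      using F pos by (meson positive_imp_inverse_positive)
  qed
  have inj: "inj_on F ?I"
    by (rule linorder_inj_onI) (use less in force)+
  have contF: "continuous_on ?I F"
    by (meson DERIV_isCont F continuous_at_imp_continuous_on)
  define X where "X = inv_into ?I F"
  have XF: "X (F x) = x" if "x \<in> ?I" for x using inj that by (simp add: X_def)
  show ?thesis
  proof
    show "open (F ` ?I)" using invariance_of_domain[OF contF _ inj] by auto
    show "is_interval (F ` ?I)"
      using connected_continuous_image[OF contF] is_interval_connected_1 by (metis connected_Ioo)
    show "0 \<in> F ` ?I" using x1 by (force simp: F_def)
    show "X 0 = x1" using XF[OF x1] by (simp add: F_def)
    show "X ` F ` ?I = ?I" using XF by (force simp: image_image)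
    fix t assume "t \<in> F ` ?I"
    then obtain x where x: "x \<in> ?I" "t = F x" by auto
    have "(X has_derivative (*) (f x)) (at (F x))"
    proof (rule has_derivative_inverse_strong[OF _ x(1) contF])
      show "(F has_derivative (*) (inverse (f x))) (at x)"
        using F[OF x(1)] by (simp add: has_field_derivative_def)
      show "(*) (inverse (f x)) \<circ> (*) (f x) = id"
        using pos[OF x(1)] by (auto simp: fun_eq_iff)
    qed (use XF in auto)
    then show "(X has_real_derivative f (X t)) (at t)"
      using x XF by (simp add: has_field_derivative_def)
  qed
qed

text \<open>The map \<open>F x = (e \<bullet> x, r x)\<close> with \<open>e = K x0\<close>
  straightens the level sets into segments. \<open>K\<close> is tangent to them and has a positive
  \<open>e\<close>-component near \<open>x0\<close>, so each segment is a single integral curve up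
  to parametrisation, and the parametrisation solves a scalar equation.\<close>

lemma integral_curves_fill_level_sets:
  fixes r :: "real \<times> real \<Rightarrow> real" and K :: "real \<times> real \<Rightarrow> real \<times> real"
  assumes D: "open D" "x0 \<in> D"
    and r: "\<And>x. x \<in> D \<Longrightarrow> (r has_derivative r' x) (at x)"
    and r'_cont: "\<And>v. continuous_on D (\<lambda>x. r' x v)"
    and K_cont: "continuous_on D K"
    and r'K: "\<And>x. x \<in> D \<Longrightarrow> r' x (K x) = 0"
    and K0: "K x0 \<noteq> 0" and r'0: "r' x0 \<noteq> (\<lambda>v. 0)"
  obtains B where "open B" "x0 \<in> B" "B \<subseteq> D"
    "\<And>y z. y \<in> B \<Longrightarrow> z \<in> B \<Longrightarrow> r z = r y \<Longrightarrow>
       \<exists>J \<sigma> t. open J \<and> is_interval J \<and> (0::real) \<in> J \<and> t \<in> J \<and> \<sigma> 0 = y \<and> \<sigma> t = z \<and>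
       (\<forall>s\<in>J. \<sigma> s \<in> B \<and> (\<sigma> has_vector_derivative K (\<sigma> s)) (at s))"
proof -
  define e where "e = K x0"
  define n where "n = (- snd e, fst e)"
  have en: "e \<bullet> n = 0" by (simp add: n_def inner_prod_def)
  have lin: "linear (r' x)" if "x \<in> D" for x using r[OF that] has_derivative_linear by blast
  have e0: "e \<bullet> e > 0" using K0 by (simp add: e_def)
  have decomp: "(e \<bullet> e) *\<^sub>R v = (e \<bullet> v) *\<^sub>R e + (n \<bullet> v) *\<^sub>R n" for v
    by (auto simp: n_def prod_eq_iff inner_prod_def algebra_simps)
  have n0: "r' x0 n \<noteq> 0"
  proof
    assume "r' x0 n = 0"
    have "r' x0 v = 0" for v
    proof -
      have "(e \<bullet> e) *\<^sub>R r' x0 v = r' x0 ((e \<bullet> v) *\<^sub>R e + (n \<bullet> v) *\<^sub>R n)"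
        unfolding decomp[symmetric] by (simp only: linear_cmul[OF lin[OF D(2)]])
      also have "\<dots> = 0" using \<open>r' x0 n = 0\<close> r'K[OF D(2)]
        by (simp add: linear_add[OF lin[OF D(2)]] linear_cmul[OF lin[OF D(2)]] e_def)
      finally show ?thesis using e0 by simp
    qed
    then show False using r'0 by auto
  qed
  \<comment> \<open>On this neighbourhood \<open>K\<close> still points forward along
    \<open>e\<close> and \<open>r\<close> still varies along the normal \<open>n\<close>; together
    these make the derivative of \<open>F\<close> invertible.\<close>
  define D' where "D' = (D \<inter> (\<lambda>x. e \<bullet> K x) -` {0<..}) \<inter> (D \<inter> (\<lambda>x. r' x n) -` (- {0}))"
  have "open D'" unfolding D'_def
    by (intro open_Int continuous_open_preimage D(1) continuous_on_inner continuous_on_const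
        K_cont r'_cont open_greaterThan) auto
  moreover have "x0 \<in> D'" using D n0 e0 by (simp add: D'_def e_def)
  ultimately obtain \<rho> where "\<rho> > 0" and \<rho>: "ball x0 \<rho> \<subseteq> D'"
    using open_contains_ball by blast
  let ?b = "ball x0 \<rho>"
  have b: "x \<in> D" "e \<bullet> K x > 0" "r' x n \<noteq> 0" if "x \<in> ?b" for x
    using that \<rho> by (auto simp: D'_def)
  define F where "F = (\<lambda>x. (e \<bullet> x, r x))"
  have F: "(F has_derivative (\<lambda>v. (e \<bullet> v, r' x v))) (at x)" if "x \<in> ?b" for x
    unfolding F_def using r[OF b(1)[OF that]] by (auto intro!: derivative_eq_intros)
  have contF: "continuous_on ?b F"
    by (meson F continuous_at_imp_continuous_on has_derivative_continuous)
  \<comment> \<open>Two points with the same image under \<open>F\<close> differ by a multiple of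
    \<open>n\<close> and have equal \<open>r\<close>. Rolle on the segment between them yields a
    point where \<open>r\<close> is stationary along \<open>n\<close>.\<close>
  have inj: "inj_on F ?b"
  proof (rule inj_onI, rule ccontr)
    fix x y assume xy: "x \<in> ?b" "y \<in> ?b" "F x = F y" "x \<noteq> y"
    define v where "v = y - x"
    have "e \<bullet> v = 0" using xy by (simp add: F_def v_def inner_diff_right)
    then have v: "(e \<bullet> e) *\<^sub>R v = (n \<bullet> v) *\<^sub>R n" using decomp[of v] by simp
    have nv: "n \<bullet> v \<noteq> 0" using v e0 xy(4) by (auto simp: v_def)
    have seg: "x + t *\<^sub>R v \<in> ?b" if "0 \<le> t" "t \<le> 1" for t
    proof -
      have "x + t *\<^sub>R v = (1 - t) *\<^sub>R x + t *\<^sub>R y" by (simp add: v_def algebra_simps)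
      then show ?thesis using convex_ball[of x0 \<rho>] xy that by (auto simp: convex_alt)
    qed
    define \<phi> where "\<phi> = (\<lambda>t. r (x + t *\<^sub>R v))"
    have \<phi>: "(\<phi> has_derivative (\<lambda>h. r' (x + t *\<^sub>R v) (h *\<^sub>R v))) (at t)" if "0 \<le> t" "t \<le> 1" for t
      unfolding \<phi>_def
      by (rule has_derivative_compose[of "\<lambda>t. x + t *\<^sub>R v" "\<lambda>h. h *\<^sub>R v" _ _ r])
         (auto intro!: derivative_eq_intros r[OF b(1)[OF seg[OF that]]])
    have "\<exists>z. 0 < z \<and> z < 1 \<and> (\<lambda>h. r' (x + z *\<^sub>R v) (h *\<^sub>R v)) = (\<lambda>v. 0)"
    proof (rule Rolle_deriv)
      show "\<phi> 0 = \<phi> 1" using xy by (simp add: \<phi>_def v_def F_def)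
      show "continuous_on {0..1} \<phi>"
        by (intro continuous_at_imp_continuous_on ballI has_derivative_continuous[OF \<phi>]) auto
    qed (use \<phi> in auto)
    then obtain z where z: "0 < z" "z < 1" "\<And>h. r' (x + z *\<^sub>R v) (h *\<^sub>R v) = 0" by metis
    let ?z = "x + z *\<^sub>R v"
    have zb: "?z \<in> ?b" using seg z by simp
    have "(n \<bullet> v) *\<^sub>R r' ?z n = r' ?z ((e \<bullet> e) *\<^sub>R v)"
      unfolding v by (simp add: linear_cmul[OF lin[OF b(1)[OF zb]]])
    then show False using z nv b(3)[OF zb] by simp
  qed
  have "open (F ` ?b)" by (rule invariance_of_domain[OF contF _ inj]) simp
  moreover have "F x0 \<in> F ` ?b" using \<open>\<rho> > 0\<close> by simp
  ultimately obtain I1 I2 where I: "open I1" "open I2" "F x0 \<in> I1 \<times> I2" "I1 \<times> I2 \<subseteq> F ` ?b"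
    by (metis open_prod_elim)
  obtain \<delta> where \<delta>: "\<delta> > 0" "ball (e \<bullet> x0) \<delta> \<subseteq> I1"
    using I open_contains_ball by (metis F_def mem_Sigma_iff)
  define I where "I = {e \<bullet> x0 - \<delta><..<e \<bullet> x0 + \<delta>}"
  have I_sub: "I \<times> I2 \<subseteq> F ` ?b"
    using I \<delta> by (auto simp: I_def ball_eq_greaterThanLessThan)
  define G where "G = inv_into ?b F"
  have GF: "G (F x) = x" if "x \<in> ?b" for x using inj that by (simp add: G_def)
  \<comment> \<open>\<open>F\<close> maps \<open>B\<close> onto the full product
    \<open>I \<times> I2\<close>, so each level set inside \<open>B\<close> is parametrised by all
    of \<open>I\<close> and cannot break into separate pieces.\<close>
  define B where "B = {x \<in> ?b. F x \<in> I \<times> I2}"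
  have openB: "open B" unfolding B_def
    using continuous_open_preimage[OF contF, of "I \<times> I2"] I(2)
    by (simp add: I_def vimage_def Int_def open_Times)
  have GB: "G (s, c) \<in> B" "F (G (s, c)) = (s, c)" if "s \<in> I" "c \<in> I2" for s c
  proof -
    have "(s, c) \<in> F ` ?b" using I_sub that by auto
    then obtain x where "x \<in> ?b" "F x = (s, c)" by auto
    then have "G (s, c) = x" "x \<in> B" using GF[of x] that by (auto simp: B_def)
    then show "G (s, c) \<in> B" "F (G (s, c)) = (s, c)" using \<open>F x = (s, c)\<close> by auto
  qed
  show ?thesis
  proof
    show "open B" by fact
    show "x0 \<in> B" using \<open>\<rho> > 0\<close> I(3) \<delta>(1) by (simp add: B_def I_def F_def)
    show "B \<subseteq> D" using b by (auto simp: B_def)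
    fix y z assume y: "y \<in> B" and z: "z \<in> B" "r z = r y"
    define c where "c = r y"
    have c: "c \<in> I2" using y by (auto simp: B_def F_def c_def)
    have yI: "e \<bullet> y \<in> I" using y by (auto simp: B_def F_def)
    define g where "g = (\<lambda>s. G (s, c))"
    have g: "(g has_vector_derivative K (g s) /\<^sub>R (e \<bullet> K (g s))) (at s)" if "s \<in> I" for s
    proof -
      define x where "x = g s"
      have x: "x \<in> ?b" "F x = (s, c)" using GB[OF that c] by (auto simp: x_def g_def B_def)
      \<comment> \<open>Inverse of the derivative of \<open>F\<close>: the normalised
        \<open>K\<close> has \<open>e\<close>-component 1 and is killed by \<open>r'\<close>, while
        the normalised \<open>n\<close> is orthogonal to \<open>e\<close> and has
        \<open>r'\<close>-value 1.\<close>
      define g' where "g' = (\<lambda>w. fst w *\<^sub>R (K x /\<^sub>R (e \<bullet> K x)) + snd w *\<^sub>R (n /\<^sub>R r' x n))"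
      have "(G has_derivative g') (at (F x))"
      proof (rule has_derivative_inverse_strong[OF _ x(1) contF _ F[OF x(1)]])
        have "(e \<bullet> g' w, r' x (g' w)) = w" for w
          using b[OF x(1)] lin[OF b(1)[OF x(1)]] r'K[OF b(1)[OF x(1)]] en
          by (cases w) (simp add: g'_def inner_add_right linear_add linear_cmul)
        then show "(\<lambda>v. (e \<bullet> v, r' x v)) \<circ> g' = id" by (auto simp: fun_eq_iff)
      qed (use GF in auto)
      then have "(G has_derivative g') (at (s, c))" using x by simp
      then have "(g has_derivative (\<lambda>h. g' (h, 0))) (at s)" unfolding g_def
        by (rule has_derivative_compose[of "\<lambda>s. (s, c)" "\<lambda>h. (h, 0)" s UNIV G, rotated])
           (auto intro!: derivative_eq_intros)
      then show ?thesis by (simp add: has_vector_derivative_def g'_def x_def)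
    qed
    have contg: "continuous_on I g"
      by (meson g continuous_at_imp_continuous_on has_vector_derivative_continuous)
    have gB: "g s \<in> B" "e \<bullet> K (g s) > 0" if "s \<in> I" for s
      using GB[OF that c] b by (auto simp: g_def B_def)
    have "continuous_on I (\<lambda>s. e \<bullet> K (g s))"
    proof (intro continuous_intros continuous_on_compose2[OF K_cont contg] subsetI)
      fix x assume "x \<in> g ` I"
      then have "x \<in> B" using gB(1) by blast
      then show "x \<in> D" using b(1) by (simp add: B_def)
    qed
    \<comment> \<open>The slice \<open>g\<close> runs along the level set at unit
      \<open>e\<close>-speed; reparametrising it by a solution of
      \<open>X' = e \<bullet> K (g X)\<close> restores the velocity \<open>K\<close>.\<close>
    then obtain J X where J: "open J" "is_interval J" "0 \<in> J" and X: "X 0 = e \<bullet> y" "X ` J = I"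
      "\<And>t. t \<in> J \<Longrightarrow> (X has_real_derivative e \<bullet> K (g (X t))) (at t)"
      using scalar_autonomous_ode_exists[of "e \<bullet> x0 - \<delta>" "e \<bullet> x0 + \<delta>" "\<lambda>s. e \<bullet> K (g s)" "e \<bullet> y",
          folded I_def, OF _ gB(2) yI] by blast
    have gz: "g (e \<bullet> z) = z" if "z \<in> B" "r z = r y" for z
      using GF[of z] that by (simp add: g_def c_def B_def F_def)
    have "e \<bullet> z \<in> X ` J" using X z by (auto simp: B_def F_def)
    then obtain t where t: "t \<in> J" "X t = e \<bullet> z" by auto
    show "\<exists>J \<sigma> t. open J \<and> is_interval J \<and> (0::real) \<in> J \<and> t \<in> J \<and> \<sigma> 0 = y \<and> \<sigma> t = z \<and>
       (\<forall>s\<in>J. \<sigma> s \<in> B \<and> (\<sigma> has_vector_derivative K (\<sigma> s)) (at s))"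
    proof (intro exI[of _ J] exI[of _ "g \<circ> X"] exI[of _ t] conjI ballI J t(1))
      show "(g \<circ> X) 0 = y" using X gz y by simp
      show "(g \<circ> X) t = z" using t gz z by simp
      fix s assume s: "s \<in> J"
      then have XI: "X s \<in> I" using X by auto
      show "(g \<circ> X) s \<in> B" using gB XI by simp
      have "(g \<circ> X has_vector_derivative (e \<bullet> K (g (X s))) *\<^sub>R (K (g (X s)) /\<^sub>R (e \<bullet> K (g (X s))))) (at s)"
        using X(3)[OF s] g[OF XI] by (intro vector_diff_chain_at)
          (auto simp: has_real_derivative_iff_has_vector_derivative)
      then show "(g \<circ> X has_vector_derivative K ((g \<circ> X) s)) (at s)"
        using gB(2)[OF XI] by simp
    qed
  qed
qed

subsection \<open>Geodesics of the round sphere\<close>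

text \<open>The height \<open>z = cos \<theta>\<close> along a great circle is a harmonic
  oscillation whose frequency is the speed \<open>\<omega>\<close>, so it can be written down. Then
  \<open>w\<close> is \<open>sin \<theta>\<close>, and \<open>\<phi>'\<close> comes from
  conservation of the angular momentum \<open>L\<close>. The velocity has to be nonzero because
  \<open>\<omega>\<close> is a divisor.\<close>

lemma sphere_geodesic_exists:
  fixes \<theta>0 \<phi>0 u v :: real
  assumes \<theta>0: "0 < \<theta>0" "\<theta>0 < pi" and uv: "(u, v) \<noteq> (0, 0)"
  obtains \<epsilon> \<theta> \<phi> \<theta>' \<phi>' where "\<epsilon> > 0" "\<theta> 0 = \<theta>0" "\<phi> 0 = \<phi>0" "\<theta>' 0 = u" "\<phi>' 0 = v"
    "\<And>t. \<bar>t\<bar> < \<epsilon> \<Longrightarrow> 0 < \<theta> t \<and> \<theta> t < pi"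
    "\<And>t. \<bar>t\<bar> < \<epsilon> \<Longrightarrow> (\<theta> has_real_derivative \<theta>' t) (at t)"
    "\<And>t. \<bar>t\<bar> < \<epsilon> \<Longrightarrow> (\<phi> has_real_derivative \<phi>' t) (at t)"
    "\<And>t. \<bar>t\<bar> < \<epsilon> \<Longrightarrow> (\<theta>' has_real_derivative sin (\<theta> t) * cos (\<theta> t) * (\<phi>' t)\<^sup>2) (at t)"
    "\<And>t. \<bar>t\<bar> < \<epsilon> \<Longrightarrow> (\<phi>' has_real_derivative - 2 * cos (\<theta> t) / sin (\<theta> t) * \<theta>' t * \<phi>' t) (at t)"
    "\<And>t. \<bar>t\<bar> < \<epsilon> \<Longrightarrow> (\<theta>' t)\<^sup>2 + (sin (\<theta> t))\<^sup>2 * (\<phi>' t)\<^sup>2 = u\<^sup>2 + (sin \<theta>0)\<^sup>2 * v\<^sup>2"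
proof -
  have s0: "sin \<theta>0 > 0" using \<theta>0 sin_gt_zero by blast
  define \<omega> where "\<omega> = sqrt (u\<^sup>2 + (sin \<theta>0)\<^sup>2 * v\<^sup>2)"
  have pos: "u\<^sup>2 + (sin \<theta>0)\<^sup>2 * v\<^sup>2 > 0"
  proof (cases "u = 0")
    case True
    then show ?thesis using uv s0 by simp
  next
    case False
    then show ?thesis by (intro add_pos_nonneg) auto
  qed
  have \<omega>2: "\<omega>\<^sup>2 = u\<^sup>2 + (sin \<theta>0)\<^sup>2 * v\<^sup>2" using pos by (simp add: \<omega>_def)
  have \<omega>0: "\<omega> > 0" using pos by (simp add: \<omega>_def)
  define L where "L = (sin \<theta>0)\<^sup>2 * v"
  define z where "z = (\<lambda>t. cos \<theta>0 * cos (\<omega> * t) - sin \<theta>0 * u / \<omega> * sin (\<omega> * t))"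
  define z' where "z' = (\<lambda>t. - cos \<theta>0 * \<omega> * sin (\<omega> * t) - sin \<theta>0 * u * cos (\<omega> * t))"
  define w where "w = (\<lambda>t. sqrt (1 - (z t)\<^sup>2))"
  have dz: "(z has_real_derivative z' t) (at t)" for t
    unfolding z_def z'_def using \<omega>0 by (auto intro!: derivative_eq_intros simp: field_simps)
  have dz': "(z' has_real_derivative - \<omega>\<^sup>2 * z t) (at t)" for t
    unfolding z_def z'_def using \<omega>0
    by (auto intro!: derivative_eq_intros simp: field_simps power2_eq_square)
  \<comment> \<open>Divided by the square of \<open>w\<close>, this is conservation of speed. The
    left side has zero derivative, so its value at 0 determines it. It yields both the equation for
    \<open>\<theta>'\<close> and the final speed identity.\<close>
  have L2: "\<omega>\<^sup>2 * (1 - (z t)\<^sup>2) - (z' t)\<^sup>2 = L\<^sup>2" for t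
  proof -
    have "((\<lambda>t. \<omega>\<^sup>2 * (1 - (z t)\<^sup>2) - (z' t)\<^sup>2) has_real_derivative 0) (at t)" for t
      by (auto intro!: derivative_eq_intros dz dz' simp: algebra_simps)
    then have "\<omega>\<^sup>2 * (1 - (z t)\<^sup>2) - (z' t)\<^sup>2 = \<omega>\<^sup>2 * (1 - (z 0)\<^sup>2) - (z' 0)\<^sup>2"
      by (intro DERIV_isconst_all) auto
    also have "\<dots> = \<omega>\<^sup>2 * (sin \<theta>0)\<^sup>2 - (sin \<theta>0)\<^sup>2 * u\<^sup>2"
      by (simp add: z_def z'_def power_mult_distrib sin_squared_eq)
    also have "\<dots> = L\<^sup>2" unfolding \<omega>2 L_def by algebra
    finally show ?thesis .
  qed
  \<comment> \<open>The bound on \<open>z\<close> keeps the curve away from the poles, where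
    \<open>w\<close> would vanish and the angular coordinates break down.\<close>
  have "isCont z 0" using dz DERIV_isCont by blast
  moreover have "\<bar>z 0\<bar> < 1"
    using s0 by (simp add: z_def abs_square_less_1[symmetric] cos_squared_eq)
  ultimately have "eventually (\<lambda>t. \<bar>z t\<bar> < 1) (at 0)"
    by (intro order_tendstoD[where y="\<bar>z 0\<bar>"]) (auto simp: isCont_def intro!: tendsto_intros)
  then obtain \<epsilon> where \<epsilon>: "\<epsilon> > 0" "\<And>t. t \<noteq> 0 \<Longrightarrow> \<bar>t\<bar> < \<epsilon> \<Longrightarrow> \<bar>z t\<bar> < 1"
    by (auto simp: eventually_at)
  have z1: "\<bar>z t\<bar> < 1" if "\<bar>t\<bar> < \<epsilon>" for t
    using \<epsilon>(2)[OF _ that] \<open>\<bar>z 0\<bar> < 1\<close> by (cases "t = 0") auto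
  have w: "w t > 0" "(w t)\<^sup>2 = 1 - (z t)\<^sup>2" if "\<bar>t\<bar> < \<epsilon>" for t
    using z1[OF that] abs_square_less_1[of "z t"] by (auto simp: w_def)
  have dw: "(w has_real_derivative - z t * z' t / w t) (at t)" if "\<bar>t\<bar> < \<epsilon>" for t
    using w[OF that] unfolding w_def
    by (auto intro!: derivative_eq_intros dz simp: field_simps)
  define \<theta> where "\<theta> = (\<lambda>t. arccos (z t))"
  define \<theta>' where "\<theta>' = (\<lambda>t. - z' t / w t)"
  define \<phi>' where "\<phi>' = (\<lambda>t. L / (w t)\<^sup>2)"
  have cos\<theta>: "cos (\<theta> t) = z t" and sin\<theta>: "sin (\<theta> t) = w t" if "\<bar>t\<bar> < \<epsilon>" for t
    using z1[OF that] by (auto simp: \<theta>_def w_def sin_arccos_abs)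
  have \<theta>_range: "0 < \<theta> t \<and> \<theta> t < pi" if "\<bar>t\<bar> < \<epsilon>" for t
    using z1[OF that] arccos_lt_bounded[of "z t"] by (auto simp: \<theta>_def)
  have d\<phi>': "(\<phi>' has_real_derivative - 2 * cos (\<theta> t) / sin (\<theta> t) * \<theta>' t * \<phi>' t) (at t)"
    if "\<bar>t\<bar> < \<epsilon>" for t
    unfolding \<phi>'_def \<theta>'_def cos\<theta>[OF that] sin\<theta>[OF that] using w(1)[OF that]
    by (auto intro!: derivative_eq_intros dw[OF that] simp: field_simps power2_eq_square)
  \<comment> \<open>The azimuth is obtained by integrating \<open>\<phi>'\<close>; its additive
    constant is fixed afterwards by the initial value \<open>\<phi>0\<close>.\<close>
  have "\<exists>F. \<forall>t. ereal (-\<epsilon>) < ereal t \<longrightarrow> ereal t < ereal \<epsilon> \<longrightarrow> (F has_vector_derivative \<phi>' t) (at t)"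
    by (rule einterval_antiderivative) (use \<epsilon> d\<phi>' DERIV_isCont in \<open>force simp: abs_less_iff\<close>)+
  then obtain \<phi>1 where \<phi>1: "(\<phi>1 has_real_derivative \<phi>' t) (at t)" if "\<bar>t\<bar> < \<epsilon>" for t
    by (force simp: has_real_derivative_iff_has_vector_derivative abs_less_iff)
  define \<phi> where "\<phi> = (\<lambda>t. \<phi>1 t - \<phi>1 0 + \<phi>0)"
  have w0: "w 0 = sin \<theta>0" using s0 by (simp add: w_def z_def sin_squared_eq[symmetric])
  show ?thesis
  proof (rule that[of \<epsilon> \<theta> \<phi> \<theta>' \<phi>'])
    show "\<epsilon> > 0" by fact
    show "\<theta> 0 = \<theta>0" using \<theta>0 by (simp add: \<theta>_def z_def arccos_cos)
    show "\<phi> 0 = \<phi>0" by (simp add: \<phi>_def)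
    show "\<theta>' 0 = u" using s0 by (simp add: \<theta>'_def w0 z'_def)
    show "\<phi>' 0 = v" using s0 by (simp add: \<phi>'_def w0 L_def)
    fix t :: real assume t: "\<bar>t\<bar> < \<epsilon>"
    show "0 < \<theta> t \<and> \<theta> t < pi" using \<theta>_range t .
    show "(\<theta> has_real_derivative \<theta>' t) (at t)"
      unfolding \<theta>_def \<theta>'_def using z1[OF t] w(1)[OF t]
      by (auto intro!: derivative_eq_intros dz simp: w_def field_simps)
    show "(\<phi> has_real_derivative \<phi>' t) (at t)"
      unfolding \<phi>_def by (auto intro!: derivative_eq_intros \<phi>1 t)
    show "(\<theta>' has_real_derivative sin (\<theta> t) * cos (\<theta> t) * (\<phi>' t)\<^sup>2) (at t)"
    proof -
      have "(\<theta>' has_real_derivative z t * (\<omega>\<^sup>2 * (w t)\<^sup>2 - (z' t)\<^sup>2) / (w t)^3) (at t)"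
        unfolding \<theta>'_def using w(1)[OF t]
        by (auto intro!: derivative_eq_intros dw[OF t] dz' simp: field_simps power2_eq_square power3_eq_cube)
      moreover have "\<omega>\<^sup>2 * (w t)\<^sup>2 - (z' t)\<^sup>2 = L\<^sup>2" using L2[of t] w(2)[OF t] by simp
      ultimately have "(\<theta>' has_real_derivative z t * L\<^sup>2 / (w t)^3) (at t)" by simp
      then show ?thesis
        unfolding \<phi>'_def cos\<theta>[OF t] sin\<theta>[OF t] using w(1)[OF t]
        by (simp add: field_simps power2_eq_square power3_eq_cube)
    qed
    show "(\<phi>' has_real_derivative - 2 * cos (\<theta> t) / sin (\<theta> t) * \<theta>' t * \<phi>' t) (at t)"
      using d\<phi>' t .
    show "(\<theta>' t)\<^sup>2 + (sin (\<theta> t))\<^sup>2 * (\<phi>' t)\<^sup>2 = u\<^sup>2 + (sin \<theta>0)\<^sup>2 * v\<^sup>2"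
    proof -
      have "(z' t)\<^sup>2 + L\<^sup>2 = \<omega>\<^sup>2 * (w t)\<^sup>2" using L2[of t] w(2)[OF t] by simp
      then show ?thesis
        unfolding \<phi>'_def \<theta>'_def sin\<theta>[OF t] \<omega>2[symmetric] using w(1)[OF t]
        by (simp add: field_simps power2_eq_square)
    qed
  qed
qed

subsection \<open>Connection coefficients of the metric\<close>

definition d1 :: "(real \<times> real \<Rightarrow> real) \<Rightarrow> real \<times> real \<Rightarrow> real" where
  "d1 f x = frechet_derivative f (at x) (1, 0)"

definition d2 :: "(real \<times> real \<Rightarrow> real) \<Rightarrow> real \<times> real \<Rightarrow> real" where
  "d2 f x = frechet_derivative f (at x) (0, 1)"

section \<open>Functions of (x^0, x^1) and their lifts to the chart\<close>

lemma smooth_fun_differentiable: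
  assumes "smooth_fun D f" "open D" "x \<in> D"
  shows "f differentiable (at x)"
proof -
  have "Ck (Suc 0) D f" using assms(1) unfolding smooth_fun_def by blast
  then show ?thesis using assms(2,3) by (simp add: differentiable_on_eq_differentiable_at)
qed

lemma smooth_fun_d1: "smooth_fun D f \<Longrightarrow> smooth_fun D (d1 f)"
  and smooth_fun_d2: "smooth_fun D f \<Longrightarrow> smooth_fun D (d2 f)"
proof -
  have "Ck k D (\<lambda>x. frechet_derivative f (at x) v)"
    if "smooth_fun D f" "v \<in> Basis" for k and v :: "real \<times> real"
  proof -
    have "Ck (Suc k) D f" using that(1) unfolding smooth_fun_def by blast
    then show ?thesis using that(2) by simp
  qed
  from this[of "(1, 0)"] this[of "(0, 1)"]
  show "smooth_fun D f \<Longrightarrow> smooth_fun D (d1 f)" "smooth_fun D f \<Longrightarrow> smooth_fun D (d2 f)"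
    unfolding smooth_fun_def d1_def d2_def by (auto simp: Basis_prod_def)
qed

lemma smooth_fun_continuous_on: "smooth_fun D f \<Longrightarrow> continuous_on D f"
  unfolding smooth_fun_def by (metis Ck.simps(1))

lemma has_derivative_d12:
  assumes "f differentiable (at x)"
  shows "(f has_derivative (\<lambda>v. d1 f x * fst v + d2 f x * snd v)) (at x)"
proof -
  have D: "(f has_derivative frechet_derivative f (at x)) (at x)"
    using assms frechet_derivative_works by blast
  then have lin: "linear (frechet_derivative f (at x))" by (rule has_derivative_linear)
  have "frechet_derivative f (at x) v = d1 f x * fst v + d2 f x * snd v" for v
  proof -
    have "v = fst v *\<^sub>R (1, 0) + snd v *\<^sub>R (0, 1)" by (simp add: prod_eq_iff)
    then have "frechet_derivative f (at x) v
      = fst v *\<^sub>R frechet_derivative f (at x) (1, 0) + snd v *\<^sub>R frechet_derivative f (at x) (0, 1)"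
      by (metis linear_add[OF lin] linear_cmul[OF lin])
    then show ?thesis by (simp add: d1_def d2_def)
  qed
  then have "frechet_derivative f (at x) = (\<lambda>v. d1 f x * fst v + d2 f x * snd v)" by (rule ext)
  then show ?thesis using D by simp
qed

lemma has_derivative_lift2:
  assumes "f differentiable (at (p $ 1, p $ 2))"
  shows "(lift2 f has_derivative
           (\<lambda>v. d1 f (p $ 1, p $ 2) * v $ 1 + d2 f (p $ 1, p $ 2) * v $ 2)) (at p)"
proof -
  have "((\<lambda>q::real^4. (q $ 1, q $ 2)) has_derivative (\<lambda>v. (v $ 1, v $ 2))) (at p)"
    by (intro has_derivative_Pair bounded_linear_imp_has_derivative bounded_linear_vec_nth)
  from has_derivative_compose[OF this has_derivative_d12[OF assms]]
  show ?thesis by (simp add: lift2_def[abs_def])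
qed

lemma partial_eqI: "(f has_derivative f') (at p) \<Longrightarrow> partial i f p = f' (axis i 1)"
  unfolding partial_def using frechet_derivative_at by metis

text \<open>Needed for second partial derivatives: the inner derivative is computed only on the open
  chart domain, and the outer one depends only on values near the point.\<close>

lemma partial_cong_open:
  assumes "open U" "p \<in> U" "\<And>q. q \<in> U \<Longrightarrow> f q = g q" and "g differentiable (at p)"
  shows "partial i f p = partial i g p"
proof -
  have g: "(g has_derivative frechet_derivative g (at p)) (at p)"
    using assms(4) frechet_derivative_works by blast
  then have "(f has_derivative frechet_derivative g (at p)) (at p)"
    by (rule has_derivative_transform_within_open[OF _ assms(1,2)]) (use assms(3) in auto)
  then show ?thesis using partial_eqI g by metis
qed

lemma axis_4_nth [simp]:
  "axis (1::4) (1::real) $ 1 = 1" "axis (1::4) (1::real) $ 2 = 0"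
  "axis (1::4) (1::real) $ 3 = 0" "axis (1::4) (1::real) $ 4 = 0"
  "axis (2::4) (1::real) $ 1 = 0" "axis (2::4) (1::real) $ 2 = 1"
  "axis (2::4) (1::real) $ 3 = 0" "axis (2::4) (1::real) $ 4 = 0"
  "axis (3::4) (1::real) $ 1 = 0" "axis (3::4) (1::real) $ 2 = 0"
  "axis (3::4) (1::real) $ 3 = 1" "axis (3::4) (1::real) $ 4 = 0"
  "axis (4::4) (1::real) $ 1 = 0" "axis (4::4) (1::real) $ 2 = 0"
  "axis (4::4) (1::real) $ 3 = 0" "axis (4::4) (1::real) $ 4 = 1"
  by (simp_all add: axis_def)

lemma partial_lift2:
  assumes "f differentiable (at (p $ 1, p $ 2))"
  shows "partial 1 (lift2 f) p = d1 f (p $ 1, p $ 2)" "partial 2 (lift2 f) p = d2 f (p $ 1, p $ 2)"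
    "partial 3 (lift2 f) p = 0" "partial 4 (lift2 f) p = 0"
  using partial_eqI[OF has_derivative_lift2[OF assms]] by simp_all

lemma partial_const [simp]: "partial i (\<lambda>q. c) p = 0"
  using partial_eqI[OF has_derivative_const] .

lemma partial_lift2_sin:
  assumes "f differentiable (at (p $ 1, p $ 2))"
  defines "F \<equiv> \<lambda>q. lift2 f q * (sin (q $ 3))\<^sup>2"
  shows "partial 1 F p = d1 f (p $ 1, p $ 2) * (sin (p $ 3))\<^sup>2"
    "partial 2 F p = d2 f (p $ 1, p $ 2) * (sin (p $ 3))\<^sup>2"
    "partial 3 F p = 2 * lift2 f p * sin (p $ 3) * cos (p $ 3)" "partial 4 F p = 0"
proof -
  have "((\<lambda>q::real^4. sin (q $ 3)) has_derivative (\<lambda>v. cos (p $ 3) * v $ 3)) (at p)"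
    by (auto intro!: derivative_eq_intros bounded_linear_imp_has_derivative)
  then have "((\<lambda>q::real^4. (sin (q $ 3))\<^sup>2) has_derivative (\<lambda>v. 2 * sin (p $ 3) * cos (p $ 3) * v $ 3)) (at p)"
    by (rule has_derivative_eq_rhs[OF has_derivative_power]) (auto simp: fun_eq_iff)
  note partial_eqI[OF has_derivative_mult[OF has_derivative_lift2[OF assms(1)] this]]
  then show "partial 1 F p = d1 f (p $ 1, p $ 2) * (sin (p $ 3))\<^sup>2"
    "partial 2 F p = d2 f (p $ 1, p $ 2) * (sin (p $ 3))\<^sup>2"
    "partial 3 F p = 2 * lift2 f p * sin (p $ 3) * cos (p $ 3)" "partial 4 F p = 0"
    unfolding F_def by simp_all
qed

lemma sss_metric_nth:
  "sss_metric a b c d p $ 1 $ 1 = lift2 a p" "sss_metric a b c d p $ 1 $ 2 = lift2 b p"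
  "sss_metric a b c d p $ 1 $ 3 = 0" "sss_metric a b c d p $ 1 $ 4 = 0"
  "sss_metric a b c d p $ 2 $ 1 = lift2 b p" "sss_metric a b c d p $ 2 $ 2 = lift2 c p"
  "sss_metric a b c d p $ 2 $ 3 = 0" "sss_metric a b c d p $ 2 $ 4 = 0"
  "sss_metric a b c d p $ 3 $ 1 = 0" "sss_metric a b c d p $ 3 $ 2 = 0"
  "sss_metric a b c d p $ 3 $ 3 = lift2 d p" "sss_metric a b c d p $ 3 $ 4 = 0"
  "sss_metric a b c d p $ 4 $ 1 = 0" "sss_metric a b c d p $ 4 $ 2 = 0"
  "sss_metric a b c d p $ 4 $ 3 = 0" "sss_metric a b c d p $ 4 $ 4 = lift2 d p * (sin (p $ 3))\<^sup>2"
  by (simp_all add: sss_metric_def)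

text \<open>\<open>matrix_inv\<close> is defined by choice, so a witness is needed before anything
  is known about it; uniqueness of two-sided inverses then identifies it.\<close>

lemma matrix_inv_eqI:
  fixes A B :: "real^'n^'n"
  assumes "A ** B = mat 1" "B ** A = mat 1"
  shows "matrix_inv A = B"
proof -
  have "A ** matrix_inv A = mat 1 \<and> matrix_inv A ** A = mat 1"
    unfolding matrix_inv_def by (rule someI[of _ B]) (use assms in blast)
  then show ?thesis using assms by (metis matrix_mul_assoc matrix_mul_lid matrix_mul_rid)
qed

lemma open_chartdom: "open D \<Longrightarrow> open (chartdom D)"
proof -
  assume "open D"
  then have "open ((\<lambda>p::real^4. (p $ 1, p $ 2)) -` D)"
    by (intro open_vimage continuous_intros)
  moreover have "open {p::real^4. 0 < p $ 3}" "open {p::real^4. p $ 3 < pi}"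
    by (intro open_Collect_less continuous_intros)+
  moreover have "chartdom D = (\<lambda>p::real^4. (p $ 1, p $ 2)) -` D \<inter> {p. 0 < p $ 3} \<inter> {p. p $ 3 < pi}"
    by (auto simp: chartdom_def)
  ultimately show ?thesis by auto
qed

text \<open>The annihilator of a nonzero covector in the plane is a line. Applied with
  \<open>dr\<close> as covector, it makes the non-angular part of every vector tangent to a level
  set of \<open>r\<close> a multiple of (\<open>d2 r\<close>, \<open>- d1 r\<close>).\<close>

lemma orthogonal_to_nonzero_2:
  fixes a b c d :: real
  assumes "(a, b) \<noteq> (0, 0)" "a * c + b * d = 0"
  obtains \<mu> where "c = \<mu> * b" "d = - \<mu> * a"
proof (cases "a = 0")
  case True
  then show ?thesis using assms that[of "c / b"] by simp
next
  case False
  then show ?thesis using assms(2) that[of "- d / a"] by (simp add: field_simps)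
qed

section \<open>Inverse metric and geodesic acceleration in the chart\<close>

locale sss_chart =
  fixes D :: "(real \<times> real) set" and g00 g01 g11 gth :: "real \<times> real \<Rightarrow> real"
  assumes D_open: "open D"
    and smooth: "smooth_fun D g00" "smooth_fun D g01" "smooth_fun D g11" "smooth_fun D gth"
    and gth_pos: "\<And>x. x \<in> D \<Longrightarrow> gth x > 0"
    and lorentzian: "\<And>x. x \<in> D \<Longrightarrow> g00 x * g11 x - (g01 x)\<^sup>2 < 0"
begin

abbreviation "G \<equiv> sss_metric g00 g01 g11 gth"
abbreviation "U \<equiv> chartdom D"

definition \<Delta> :: "real \<times> real \<Rightarrow> real" where "\<Delta> x = g00 x * g11 x - (g01 x)\<^sup>2"

lemma chartD: "p \<in> U \<Longrightarrow> (p $ 1, p $ 2) \<in> D" "p \<in> U \<Longrightarrow> sin (p $ 3) > 0"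
  by (auto simp: chartdom_def intro!: sin_gt_zero)

lemma \<Delta>_neg: "x \<in> D \<Longrightarrow> \<Delta> x < 0"
  using lorentzian by (simp add: \<Delta>_def)

lemma ginv_eq:
  assumes p: "p \<in> U"
  defines "x \<equiv> (p $ 1, p $ 2)"
  shows "ginv G p 1 1 = g11 x / \<Delta> x" "ginv G p 1 2 = - g01 x / \<Delta> x"
    "ginv G p 1 3 = 0" "ginv G p 1 4 = 0"
    "ginv G p 2 1 = - g01 x / \<Delta> x" "ginv G p 2 2 = g00 x / \<Delta> x"
    "ginv G p 2 3 = 0" "ginv G p 2 4 = 0"
    "ginv G p 3 1 = 0" "ginv G p 3 2 = 0" "ginv G p 3 3 = 1 / gth x" "ginv G p 3 4 = 0"
    "ginv G p 4 1 = 0" "ginv G p 4 2 = 0" "ginv G p 4 3 = 0"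
    "ginv G p 4 4 = 1 / (gth x * (sin (p $ 3))\<^sup>2)"
proof -
  define B :: "real^4^4" where "B = (\<chi> i. \<chi> j.
     if i = 1 \<and> j = 1 then g11 x / \<Delta> x
     else if (i = 1 \<and> j = 2) \<or> (i = 2 \<and> j = 1) then - g01 x / \<Delta> x
     else if i = 2 \<and> j = 2 then g00 x / \<Delta> x
     else if i = 3 \<and> j = 3 then 1 / gth x
     else if i = 4 \<and> j = 4 then 1 / (gth x * (sin (p $ 3))\<^sup>2)
     else 0)"
  have x: "x \<in> D" using chartD(1)[OF p] by (simp add: x_def)
  have nz: "\<Delta> x \<noteq> 0" "gth x \<noteq> 0" "sin (p $ 3) \<noteq> 0"
    using \<Delta>_neg[OF x] gth_pos[OF x] chartD(2)[OF p] by auto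
  have det: "g00 x * g11 x = \<Delta> x + g01 x * g01 x" by (simp add: \<Delta>_def power2_eq_square)
  have L: "lift2 f p = f x" for f by (simp add: lift2_def x_def)
  have "matrix_inv (G p) = B"
    by (rule matrix_inv_eqI; simp add: vec_eq_iff forall_4 matrix_matrix_mult_def sum_4 mat_def
        sss_metric_nth B_def L nz) (use nz det in \<open>auto simp: field_simps\<close>)
  then show "ginv G p 1 1 = g11 x / \<Delta> x" "ginv G p 1 2 = - g01 x / \<Delta> x"
    "ginv G p 1 3 = 0" "ginv G p 1 4 = 0"
    "ginv G p 2 1 = - g01 x / \<Delta> x" "ginv G p 2 2 = g00 x / \<Delta> x"
    "ginv G p 2 3 = 0" "ginv G p 2 4 = 0"
    "ginv G p 3 1 = 0" "ginv G p 3 2 = 0" "ginv G p 3 3 = 1 / gth x" "ginv G p 3 4 = 0"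
    "ginv G p 4 1 = 0" "ginv G p 4 2 = 0" "ginv G p 4 3 = 0"
    "ginv G p 4 4 = 1 / (gth x * (sin (p $ 3))\<^sup>2)"
    by (simp_all add: ginv_def B_def)
qed

lemma metric_differentiable:
  assumes "x \<in> D"
  shows "g00 differentiable (at x)" "g01 differentiable (at x)" "g11 differentiable (at x)"
    "gth differentiable (at x)"
  using smooth smooth_fun_differentiable D_open assms by blast+

text \<open>The sign is that of the Christoffel term: a geodesic with velocity \<open>k\<close> has
  coordinate acceleration \<open>- accel p k\<close>.\<close>

definition accel :: "real^4 \<Rightarrow> real^4 \<Rightarrow> 4 \<Rightarrow> real" where
  "accel p k m = (\<Sum>i\<in>UNIV. \<Sum>j\<in>UNIV. christoffel G p m i j * k $ i * k $ j)"

text \<open>The two non-angular components of the geodesic acceleration term \<open>accel\<close> with the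
  index lowered.\<close>

definition accel_low1 :: "real^4 \<Rightarrow> real^4 \<Rightarrow> real" where
  "accel_low1 p k = (let x = (p $ 1, p $ 2) in d1 g00 x * (k $ 1)\<^sup>2 / 2 + d2 g00 x * k $ 1 * k $ 2
     + (d2 g01 x - d1 g11 x / 2) * (k $ 2)\<^sup>2
     - d1 gth x * ((k $ 3)\<^sup>2 + (sin (p $ 3))\<^sup>2 * (k $ 4)\<^sup>2) / 2)"

definition accel_low2 :: "real^4 \<Rightarrow> real^4 \<Rightarrow> real" where
  "accel_low2 p k = (let x = (p $ 1, p $ 2) in (d1 g01 x - d2 g00 x / 2) * (k $ 1)\<^sup>2
     + d1 g11 x * k $ 1 * k $ 2 + d2 g11 x * (k $ 2)\<^sup>2 / 2
     - d2 gth x * ((k $ 3)\<^sup>2 + (sin (p $ 3))\<^sup>2 * (k $ 4)\<^sup>2) / 2)"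

text \<open>The metric is block diagonal. On the (x^0, x^1) block the inverse metric raises the
  index of the lowered terms. On the angular block the round-sphere term appears together with a
  drift proportional to the derivative of \<open>gth\<close> along \<open>k\<close>, which vanishes
  along orbits of the Killing field.\<close>

lemma accel_eq:
  assumes p: "p \<in> U"
  defines "x \<equiv> (p $ 1, p $ 2)"
  shows "accel p k 1 = (g11 x * accel_low1 p k - g01 x * accel_low2 p k) / \<Delta> x"
    "accel p k 2 = (g00 x * accel_low2 p k - g01 x * accel_low1 p k) / \<Delta> x"
    "accel p k 3 = (d1 gth x * k $ 1 + d2 gth x * k $ 2) * k $ 3 / gth x
        - sin (p $ 3) * cos (p $ 3) * (k $ 4)\<^sup>2"
    "accel p k 4 = (d1 gth x * k $ 1 + d2 gth x * k $ 2) * k $ 4 / gth x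
        + 2 * cos (p $ 3) / sin (p $ 3) * k $ 3 * k $ 4"
proof -
  have x: "x \<in> D" using chartD(1)[OF p] by (simp add: x_def)
  note d = metric_differentiable[OF x, unfolded x_def]
  have nz: "\<Delta> x \<noteq> 0" "gth x \<noteq> 0" "sin (p $ 3) \<noteq> 0"
    using \<Delta>_neg[OF x] gth_pos[OF x] chartD(2)[OF p] by auto
  note S = christoffel_def sum_4 ginv_eq[OF p, folded x_def] sss_metric_nth
     d[THEN partial_lift2(1), folded x_def] d[THEN partial_lift2(2), folded x_def]
     d[THEN partial_lift2(3)] d[THEN partial_lift2(4)] partial_lift2_sin[OF d(4), folded x_def]
  have L: "lift2 f p = f x" for f by (simp add: lift2_def x_def)
  show "accel p k 1 = (g11 x * accel_low1 p k - g01 x * accel_low2 p k) / \<Delta> x"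
    using nz by (simp add: accel_def S accel_low1_def accel_low2_def Let_def x_def[symmetric] divide_simps)
      (simp add: algebra_simps power2_eq_square)
  show "accel p k 2 = (g00 x * accel_low2 p k - g01 x * accel_low1 p k) / \<Delta> x"
    using nz by (simp add: accel_def S accel_low1_def accel_low2_def Let_def x_def[symmetric] divide_simps)
      (simp add: algebra_simps power2_eq_square)
  show "accel p k 3 = (d1 gth x * k $ 1 + d2 gth x * k $ 2) * k $ 3 / gth x
        - sin (p $ 3) * cos (p $ 3) * (k $ 4)\<^sup>2"
    using nz by (simp add: accel_def S L divide_simps) (simp add: algebra_simps power2_eq_square)
  show "accel p k 4 = (d1 gth x * k $ 1 + d2 gth x * k $ 2) * k $ 4 / gth x
        + 2 * cos (p $ 3) / sin (p $ 3) * k $ 3 * k $ 4"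
    using nz by (simp add: accel_def S L divide_simps) (simp add: algebra_simps power2_eq_square)
qed

end

subsection \<open>The photon condition as a Hessian along null vectors\<close>

context sss_chart
begin

lemma gform_eq:
  "gform G p v w = (let x = (p $ 1, p $ 2) in
     g00 x * v $ 1 * w $ 1 + g01 x * (v $ 1 * w $ 2 + v $ 2 * w $ 1) + g11 x * v $ 2 * w $ 2
     + gth x * (v $ 3 * w $ 3 + (sin (p $ 3))\<^sup>2 * v $ 4 * w $ 4))"
  by (simp add: gform_def sum_4 sss_metric_nth lift2_def Let_def algebra_simps)

lemma partial_partial_lift2:
  assumes r: "smooth_fun D r" and p: "p \<in> U"
  defines "x \<equiv> (p $ 1, p $ 2)"
  shows "partial 1 (\<lambda>q. partial 1 (lift2 r) q) p = d1 (d1 r) x"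
    "partial 2 (\<lambda>q. partial 1 (lift2 r) q) p = d2 (d1 r) x"
    "partial 1 (\<lambda>q. partial 2 (lift2 r) q) p = d1 (d2 r) x"
    "partial 2 (\<lambda>q. partial 2 (lift2 r) q) p = d2 (d2 r) x"
proof -
  note U = open_chartdom[OF D_open]
  have diff: "f differentiable (at (q $ 1, q $ 2))" if "smooth_fun D f" "q \<in> U" for f q
    using smooth_fun_differentiable[OF that(1) D_open] chartD(1)[OF that(2)] by blast
  note d = partial_lift2[OF diff[OF r]]
  note e1 = diff[OF smooth_fun_d1[OF r] p] and e2 = diff[OF smooth_fun_d2[OF r] p]
  have "partial i (\<lambda>q. partial 1 (lift2 r) q) p = partial i (lift2 (d1 r)) p" for i
    using has_derivative_lift2[OF e1]
    by (intro partial_cong_open[OF U p]) (auto simp: d lift2_def differentiable_def)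
  moreover have "partial i (\<lambda>q. partial 2 (lift2 r) q) p = partial i (lift2 (d2 r)) p" for i
    using has_derivative_lift2[OF e2]
    by (intro partial_cong_open[OF U p]) (auto simp: d lift2_def differentiable_def)
  ultimately show "partial 1 (\<lambda>q. partial 1 (lift2 r) q) p = d1 (d1 r) x"
    "partial 2 (\<lambda>q. partial 1 (lift2 r) q) p = d2 (d1 r) x"
    "partial 1 (\<lambda>q. partial 2 (lift2 r) q) p = d1 (d2 r) x"
    "partial 2 (\<lambda>q. partial 2 (lift2 r) q) p = d2 (d2 r) x"
    using partial_lift2[OF e1] partial_lift2[OF e2] by (simp_all add: x_def)
qed

text \<open>The coordinate Hessian as a quadratic form. Both mixed partials are kept, in the form in
  which differentiating twice along a curve produces them.\<close>

definition D2 :: "(real \<times> real \<Rightarrow> real) \<Rightarrow> real \<times> real \<Rightarrow> real \<Rightarrow> real \<Rightarrow> real" where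
  "D2 r x a b = d1 (d1 r) x * a\<^sup>2 + (d1 (d2 r) x + d2 (d1 r) x) * a * b + d2 (d2 r) x * b\<^sup>2"

text \<open>The covariant Hessian of \<open>r\<close> evaluated on (k, k). Only the first two
  components of \<open>accel\<close> enter, since \<open>r\<close> depends on (x^0, x^1)
  alone.\<close>

definition hess_quad :: "(real \<times> real \<Rightarrow> real) \<Rightarrow> real^4 \<Rightarrow> real^4 \<Rightarrow> real" where
  "hess_quad r p k = (let x = (p $ 1, p $ 2) in
     D2 r x (k $ 1) (k $ 2) - d1 r x * accel p k 1 - d2 r x * accel p k 2)"

text \<open>\<open>T\<close> is the vector epsilon^{ab} r_b without its factor 1/sqrt(-\<Delta>).
  Two epsilons occur, so the square roots multiply to 1/(-\<Delta>) and the contraction is the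
  Hessian on (T, T) over -\<Delta>. The other two factors are the squared norm of the gradient of
  \<open>r\<close> and the derivative of \<open>gth\<close> along that gradient.\<close>

lemma photon_condition_eq:
  assumes r: "smooth_fun D r" and p: "p \<in> U"
  defines "x \<equiv> (p $ 1, p $ 2)"
  defines "T \<equiv> (\<chi> i. if i = 1 then d2 r x else if i = 2 then - d1 r x else 0) :: real^4"
  shows "photon_condition G (lift2 r) (lift2 gth) p \<longleftrightarrow>
    2 * gth x * (hess_quad r p T / (- \<Delta> x)) +
    ((g11 x * (d1 r x)\<^sup>2 - 2 * g01 x * d1 r x * d2 r x + g00 x * (d2 r x)\<^sup>2) / \<Delta> x) *
    ((g11 x * d1 r x * d1 gth x - g01 x * (d1 r x * d2 gth x + d2 r x * d1 gth x)
       + g00 x * d2 r x * d2 gth x) / \<Delta> x) = 0"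
proof -
  have x: "x \<in> D" using chartD(1)[OF p] by (simp add: x_def)
  have dr: "r differentiable (at (p $ 1, p $ 2))"
    using smooth_fun_differentiable[OF r D_open x] by (simp add: x_def)
  note pr = partial_lift2[OF dr, folded x_def]
  note pg = partial_lift2[OF metric_differentiable(4)[OF x, unfolded x_def], folded x_def]
  have L: "lift2 f p = f x" for f by (simp add: lift2_def x_def)
  have \<Delta>: "\<Delta> x < 0" using \<Delta>_neg x .
  define s where "s = 1 / sqrt (- \<Delta> x)"
  have ss: "s * s = 1 / (- \<Delta> x)" using \<Delta> by (simp add: s_def)
  have e: "eps2 G p 1 2 = s" "eps2 G p 2 1 = - s"
    "eps2 G p 1 1 = 0" "eps2 G p 1 3 = 0" "eps2 G p 1 4 = 0"
    "eps2 G p 2 2 = 0" "eps2 G p 2 3 = 0" "eps2 G p 2 4 = 0"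
    "eps2 G p 3 a = 0" "eps2 G p 4 a = 0" for a
    by (simp_all add: eps2_def sss_metric_nth L \<Delta>_def s_def)
  have Tn: "T $ 1 = d2 r x" "T $ 2 = - d1 r x" "T $ 3 = 0" "T $ 4 = 0" by (simp_all add: T_def)
  have "(\<Sum>a\<in>UNIV. \<Sum>b\<in>UNIV. \<Sum>c\<in>UNIV. \<Sum>d\<in>UNIV. eps2 G p a b * eps2 G p c d *
         hess G (lift2 r) p a c * partial b (lift2 r) p * partial d (lift2 r) p)
     = s * s * hess_quad r p T"
    by (simp add: sum_4 e pr hess_def hess_quad_def x_def[symmetric] accel_def D2_def Tn Let_def
        partial_partial_lift2[OF r p, folded x_def])
      (simp add: algebra_simps power2_eq_square)
  moreover have "(\<Sum>a\<in>UNIV. \<Sum>b\<in>UNIV. ginv G p a b * partial a (lift2 r) p * partial b (lift2 r) p)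
    = (g11 x * (d1 r x)\<^sup>2 - 2 * g01 x * d1 r x * d2 r x + g00 x * (d2 r x)\<^sup>2) / \<Delta> x"
    by (simp add: sum_4 ginv_eq[OF p, folded x_def] pr power2_eq_square add_divide_distrib
        diff_divide_distrib algebra_simps)
  moreover have "(\<Sum>c\<in>UNIV. \<Sum>d\<in>UNIV. ginv G p c d * partial d (lift2 r) p * partial c (lift2 gth) p)
    = (g11 x * d1 r x * d1 gth x - g01 x * (d1 r x * d2 gth x + d2 r x * d1 gth x)
       + g00 x * d2 r x * d2 gth x) / \<Delta> x"
    by (simp add: sum_4 ginv_eq[OF p, folded x_def] pr pg power2_eq_square add_divide_distrib
        diff_divide_distrib algebra_simps)
  ultimately show ?thesis unfolding photon_condition_def by (simp add: L ss)
qed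

text \<open>Write \<open>k\<close> as \<open>\<mu>\<close> times \<open>T\<close> plus an angular
  part of squared unit-sphere length \<open>w\<close>. The angular part contributes
  \<open>M / \<Delta> x * w / 2\<close> to the Hessian, and nullness trades \<open>gth x * w\<close>
  for \<open>- \<mu>\<^sup>2 * A\<close>. So the Hessian on (k, k) is a nonzero multiple of the
  photon expression, whichever null tangent vector \<open>k\<close> was chosen.\<close>

lemma photon_condition_iff_hess_quad:
  assumes r: "smooth_fun D r" and p: "p \<in> U"
  defines "x \<equiv> (p $ 1, p $ 2)"
  assumes dr: "(d1 r x, d2 r x) \<noteq> (0, 0)"
    and k: "k \<noteq> 0" "gform G p k k = 0" "d1 r x * k $ 1 + d2 r x * k $ 2 = 0"
  shows "photon_condition G (lift2 r) (lift2 gth) p \<longleftrightarrow> hess_quad r p k = 0"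
proof -
  have x: "x \<in> D" using chartD(1)[OF p] by (simp add: x_def)
  have \<Delta>: "\<Delta> x \<noteq> 0" and Q: "gth x > 0" using \<Delta>_neg[OF x] gth_pos[OF x] by auto
  define T where "T = ((\<chi> i. if i = 1 then d2 r x else if i = 2 then - d1 r x else 0) :: real^4)"
  define w where "w = (k $ 3)\<^sup>2 + (sin (p $ 3))\<^sup>2 * (k $ 4)\<^sup>2"
  define A where "A = g11 x * (d1 r x)\<^sup>2 - 2 * g01 x * d1 r x * d2 r x + g00 x * (d2 r x)\<^sup>2"
  define M where "M = g11 x * d1 r x * d1 gth x - g01 x * (d1 r x * d2 gth x + d2 r x * d1 gth x)
       + g00 x * d2 r x * d2 gth x"
  obtain \<mu> where \<mu>: "k $ 1 = \<mu> * d2 r x" "k $ 2 = - \<mu> * d1 r x"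
    using orthogonal_to_nonzero_2[OF dr k(3)] by metis
  have null: "gth x * w = - \<mu>\<^sup>2 * A"
    using k(2) by (simp add: gform_eq x_def[symmetric] \<mu> Let_def w_def A_def algebra_simps power2_eq_square)
  \<comment> \<open>A nonzero purely angular vector is spacelike, so it cannot be null.\<close>
  have \<mu>0: "\<mu> \<noteq> 0"
  proof
    assume "\<mu> = 0"
    then have "w = 0" using null Q by simp
    then have "k $ 3 = 0" "k $ 4 = 0" using chartD(2)[OF p] unfolding w_def
      by (simp_all add: add_nonneg_eq_0_iff)
    then have "k = 0" using \<open>\<mu> = 0\<close> \<mu> by (simp add: vec_eq_iff forall_4)
    then show False using k(1) by simp
  qed
  have Tn: "T $ 1 = d2 r x" "T $ 2 = - d1 r x" "T $ 3 = 0" "T $ 4 = 0" by (simp_all add: T_def)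
  have L: "accel_low1 p k = \<mu>\<^sup>2 * accel_low1 p T - d1 gth x * w / 2" "accel_low2 p k = \<mu>\<^sup>2 * accel_low2 p T - d2 gth x * w / 2"
    by (simp_all add: accel_low1_def accel_low2_def Let_def x_def[symmetric] Tn \<mu> w_def algebra_simps power2_eq_square)
  have a: "accel p k 1 = \<mu>\<^sup>2 * accel p T 1 - (g11 x * d1 gth x - g01 x * d2 gth x) / \<Delta> x * w / 2"
    "accel p k 2 = \<mu>\<^sup>2 * accel p T 2 - (g00 x * d2 gth x - g01 x * d1 gth x) / \<Delta> x * w / 2"
    using \<Delta> by (simp_all add: accel_eq[OF p, folded x_def] L field_simps)
  have "D2 r x (k $ 1) (k $ 2) = \<mu>\<^sup>2 * D2 r x (T $ 1) (T $ 2)"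
    by (simp add: D2_def \<mu> Tn algebra_simps power2_eq_square)
  then have H: "hess_quad r p k = \<mu>\<^sup>2 * hess_quad r p T + M / \<Delta> x * w / 2"
    using \<Delta> unfolding hess_quad_def Let_def x_def[symmetric] a M_def by (simp add: field_simps)
  have "2 * gth x * hess_quad r p k = 2 * gth x * \<mu>\<^sup>2 * hess_quad r p T + M / \<Delta> x * (gth x * w)"
    unfolding H by (simp add: algebra_simps)
  \<comment> \<open>Nullness eliminates \<open>w\<close>, after which the square of
    \<open>\<mu>\<close> factors out.\<close>
  also have "\<dots> = - (\<Delta> x * \<mu>\<^sup>2) * (2 * gth x * (hess_quad r p T / (- \<Delta> x)) + A / \<Delta> x * (M / \<Delta> x))"
    unfolding null using \<Delta> by (simp add: field_simps)
  finally have "2 * gth x * hess_quad r p k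
    = - (\<Delta> x * \<mu>\<^sup>2) * (2 * gth x * (hess_quad r p T / (- \<Delta> x)) + A / \<Delta> x * (M / \<Delta> x))" .
  then have "hess_quad r p k = 0 \<longleftrightarrow>
      2 * gth x * (hess_quad r p T / (- \<Delta> x)) + A / \<Delta> x * (M / \<Delta> x) = 0"
    using Q \<Delta> \<mu>0 by (metis mult_eq_0_iff neg_equal_0_iff_equal power_not_zero zero_neq_numeral less_irrefl)
  then show ?thesis
    unfolding photon_condition_eq[OF r p] x_def[symmetric] T_def[symmetric] A_def M_def by simp
qed

end

section \<open>Differentiation along curves in the chart\<close>

lemma vector_4 [simp]:
  "(vector [a, b, c, d] :: 'a::zero^4) $ 1 = a" "(vector [a, b, c, d] :: 'a^4) $ 2 = b"
  "(vector [a, b, c, d] :: 'a^4) $ 3 = c" "(vector [a, b, c, d] :: 'a^4) $ 4 = d"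
  unfolding vector_def by simp_all

lemma has_vector_derivative_componentwise_vec:
  fixes f :: "real \<Rightarrow> real^'n"
  shows "(f has_vector_derivative v) (at t within S) \<longleftrightarrow>
    (\<forall>i. ((\<lambda>s. f s $ i) has_real_derivative v $ i) (at t within S))"
  unfolding has_vector_derivative_def has_field_derivative_def
  by (subst has_derivative_componentwise_within)
    (auto simp: Basis_vec_def inner_axis mult.commute[of _ "v $ _"])

lemma has_real_derivative_lift2:
  fixes \<gamma> :: "real \<Rightarrow> real^4"
  assumes f: "f differentiable (at (\<gamma> t $ 1, \<gamma> t $ 2))"
    and \<gamma>: "(\<gamma> has_vector_derivative v) (at t)"
  shows "((\<lambda>s. f (\<gamma> s $ 1, \<gamma> s $ 2)) has_real_derivative
     d1 f (\<gamma> t $ 1, \<gamma> t $ 2) * v $ 1 + d2 f (\<gamma> t $ 1, \<gamma> t $ 2) * v $ 2) (at t)"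
proof -
  have "((\<lambda>s. lift2 f (\<gamma> s)) has_derivative
     (\<lambda>h. d1 f (\<gamma> t $ 1, \<gamma> t $ 2) * (h *\<^sub>R v) $ 1 + d2 f (\<gamma> t $ 1, \<gamma> t $ 2) * (h *\<^sub>R v) $ 2)) (at t)"
    by (rule has_derivative_compose[OF \<gamma>[unfolded has_vector_derivative_def] has_derivative_lift2[OF f]])
  then show ?thesis
    unfolding has_field_derivative_def lift2_def
    by (rule has_derivative_eq_rhs) (auto simp: algebra_simps)
qed

lemma DERIV_const_on_open:
  fixes f :: "real \<Rightarrow> real"
  assumes "open J" "t \<in> J" "\<And>s. s \<in> J \<Longrightarrow> f s = c" "(f has_real_derivative d) (at t)"
  shows "d = 0"
proof -
  have "((\<lambda>_. c) has_real_derivative d) (at t)"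
    by (rule has_field_derivative_transform_within_open[OF assms(4,1,2)]) (use assms(3) in auto)
  then show ?thesis using DERIV_unique DERIV_const by blast
qed

context sss_chart
begin

text \<open>The chain rule applied to constancy of \<open>r\<close> gives the first equation at
  every parameter of the open set \<open>J\<close>, so it may be differentiated once more. The
  second equation becomes a statement about the covariant Hessian once the geodesic equation
  replaces \<open>\<gamma>''\<close>.\<close>

lemma derivatives_along_level_curve:
  assumes r: "smooth_fun D r" and J: "open J" "t \<in> J"
    and \<gamma>: "\<And>s. s \<in> J \<Longrightarrow> \<gamma> s \<in> U"
      "\<And>s. s \<in> J \<Longrightarrow> (\<gamma> has_vector_derivative \<gamma>' s) (at s)"
      "\<And>s. s \<in> J \<Longrightarrow> (\<gamma>' has_vector_derivative \<gamma>'' s) (at s)"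
    and const: "\<And>s. s \<in> J \<Longrightarrow> r (\<gamma> s $ 1, \<gamma> s $ 2) = c"
  defines "x \<equiv> (\<gamma> t $ 1, \<gamma> t $ 2)"
  shows "d1 r x * \<gamma>' t $ 1 + d2 r x * \<gamma>' t $ 2 = 0"
    "D2 r x (\<gamma>' t $ 1) (\<gamma>' t $ 2) + d1 r x * \<gamma>'' t $ 1 + d2 r x * \<gamma>'' t $ 2 = 0"
proof -
  have diff: "f differentiable (at (\<gamma> s $ 1, \<gamma> s $ 2))" if "smooth_fun D f" "s \<in> J" for f s
    using smooth_fun_differentiable[OF that(1) D_open] chartD(1)[OF \<gamma>(1)[OF that(2)]] by blast
  have 0: "d1 r (\<gamma> s $ 1, \<gamma> s $ 2) * \<gamma>' s $ 1 + d2 r (\<gamma> s $ 1, \<gamma> s $ 2) * \<gamma>' s $ 2 = 0"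
    if "s \<in> J" for s
    using has_real_derivative_lift2[OF diff[OF r that] \<gamma>(2)[OF that]]
    by (rule DERIV_const_on_open[OF J(1) that, rotated]) (use const in auto)
  show "d1 r x * \<gamma>' t $ 1 + d2 r x * \<gamma>' t $ 2 = 0" using 0[OF J(2)] by (simp add: x_def)
  have c: "((\<lambda>s. \<gamma>' s $ i) has_real_derivative \<gamma>'' t $ i) (at t)" for i
    using \<gamma>(3)[OF J(2)] by (simp add: has_vector_derivative_componentwise_vec)
  note h1 = has_real_derivative_lift2[OF diff[OF smooth_fun_d1[OF r] J(2)] \<gamma>(2)[OF J(2)], folded x_def]
  note h2 = has_real_derivative_lift2[OF diff[OF smooth_fun_d2[OF r] J(2)] \<gamma>(2)[OF J(2)], folded x_def]
  note h = DERIV_add[OF DERIV_mult[OF h1 c[of 1]] DERIV_mult[OF h2 c[of 2]]]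
  show "D2 r x (\<gamma>' t $ 1) (\<gamma>' t $ 2) + d1 r x * \<gamma>'' t $ 1 + d2 r x * \<gamma>'' t $ 2 = 0"
    using DERIV_const_on_open[OF J 0 h]
    by (simp add: x_def[symmetric] D2_def algebra_simps power2_eq_square)
qed

end

subsection \<open>Invariant hypersurfaces\<close>

locale sss_hypersurface = sss_chart +
  fixes r K0 K1 :: "real \<times> real \<Rightarrow> real" and \<Phi> :: "real^3 \<Rightarrow> real^4" and V :: "(real^3) set"
  assumes r_smooth: "smooth_fun D r" and K_smooth: "smooth_fun D K0" "smooth_fun D K1"
    and K_nonzero: "\<And>x. x \<in> D \<Longrightarrow> (K0 x, K1 x) \<noteq> (0, 0)"
    and K_killing: "killing_field G U (vf2 K0 K1)"
    and r_K: "\<And>x. x \<in> D \<Longrightarrow> d1 r x * K0 x + d2 r x * K1 x = 0"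
    and S_timelike: "timelike_hypersurface G U \<Phi> V"
    and S_so3: "so3_invariant U (\<Phi> ` V)"
    and S_R: "flow_invariant (vf2 K0 K1) U (\<Phi> ` V)"
    and dr_nonzero: "\<And>u. u \<in> V \<Longrightarrow>
      (d1 r (\<Phi> u $ 1, \<Phi> u $ 2), d2 r (\<Phi> u $ 1, \<Phi> u $ 2)) \<noteq> (0, 0)"
begin

definition C :: "(real \<times> real) set" where "C = (\<lambda>p. (p $ 1, p $ 2)) ` \<Phi> ` V"

lemma immersed: "open V" "\<Phi> ` V \<subseteq> U" "\<And>u. u \<in> V \<Longrightarrow> \<Phi> differentiable (at u)"
    "\<And>u. u \<in> V \<Longrightarrow> inj (frechet_derivative \<Phi> (at u))"
  using S_timelike unfolding timelike_hypersurface_def immersed_hypersurface_def by auto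

text \<open>Rotational invariance makes the hypersurface the full preimage of its planar trace
  \<open>C\<close>, which reduces questions about it to questions in the (x^0, x^1) plane.\<close>

lemma mem_S_iff: "p \<in> \<Phi> ` V \<longleftrightarrow> p \<in> U \<and> (p $ 1, p $ 2) \<in> C"
proof
  assume "p \<in> U \<and> (p $ 1, p $ 2) \<in> C"
  then obtain q where "p \<in> U" "q \<in> \<Phi> ` V" "p $ 1 = q $ 1" "p $ 2 = q $ 2" by (auto simp: C_def)
  then show "p \<in> \<Phi> ` V" using S_so3 immersed(2) unfolding so3_invariant_def by blast
qed (use immersed(2) in \<open>auto simp: C_def\<close>)

text \<open>The Killing field has no angular component, so a planar integral curve lifted to a fixed
  point of the equator is an integral curve in the chart, to which invariance of the hypersurface
  applies.\<close>

lemma C_flow_invariant: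
  assumes J: "is_interval J" "0 \<in> J" "t \<in> J"
    and \<sigma>: "\<And>s. s \<in> J \<Longrightarrow> \<sigma> s \<in> D"
      "\<And>s. s \<in> J \<Longrightarrow> (\<sigma> has_vector_derivative (K0 (\<sigma> s), K1 (\<sigma> s))) (at s)" "\<sigma> 0 \<in> C"
  shows "\<sigma> t \<in> C"
proof -
  define \<tau> :: "real \<Rightarrow> real^4" where "\<tau> = (\<lambda>s. vector [fst (\<sigma> s), snd (\<sigma> s), pi / 2, 0])"
  have \<tau>U: "\<tau> s \<in> U" if "s \<in> J" for s using \<sigma>(1)[OF that] by (simp add: \<tau>_def chartdom_def)
  have "(\<tau> has_vector_derivative vf2 K0 K1 (\<tau> s)) (at s within J)" if "s \<in> J" for s
  proof -
    have "((\<lambda>s. fst (\<sigma> s)) has_vector_derivative K0 (\<sigma> s)) (at s)"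
      "((\<lambda>s. snd (\<sigma> s)) has_vector_derivative K1 (\<sigma> s)) (at s)"
      using has_derivative_fst[OF \<sigma>(2)[OF that, unfolded has_vector_derivative_def]]
        has_derivative_snd[OF \<sigma>(2)[OF that, unfolded has_vector_derivative_def]]
      by (simp_all add: has_vector_derivative_def)
    then have "(\<tau> has_vector_derivative vf2 K0 K1 (\<tau> s)) (at s)"
      by (simp add: has_vector_derivative_componentwise_vec forall_4 \<tau>_def vf2_def
          has_real_derivative_iff_has_vector_derivative)
    then show ?thesis by (rule has_vector_derivative_at_within)
  qed
  moreover have "\<tau> 0 \<in> \<Phi> ` V" using \<sigma>(3) \<tau>U[OF J(2)] by (simp add: mem_S_iff \<tau>_def)
  ultimately have "\<tau> t \<in> \<Phi> ` V"
    using S_R J \<tau>U unfolding flow_invariant_def by blast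
  then show ?thesis unfolding mem_S_iff by (simp add: \<tau>_def)
qed

lemma r_has_derivative:
  "x \<in> D \<Longrightarrow> (r has_derivative (\<lambda>v. d1 r x * fst v + d2 r x * snd v)) (at x)"
  using has_derivative_d12 smooth_fun_differentiable[OF r_smooth D_open] by blast

lemma level_box:
  assumes "u \<in> V"
  obtains B where "open B" "(\<Phi> u $ 1, \<Phi> u $ 2) \<in> B" "B \<subseteq> D"
    "\<And>y z. y \<in> B \<Longrightarrow> z \<in> B \<Longrightarrow> r z = r y \<Longrightarrow>
       \<exists>J \<sigma> t. open J \<and> is_interval J \<and> (0::real) \<in> J \<and> t \<in> J \<and> \<sigma> 0 = y \<and> \<sigma> t = z \<and>
       (\<forall>s\<in>J. \<sigma> s \<in> B \<and> (\<sigma> has_vector_derivative (K0 (\<sigma> s), K1 (\<sigma> s))) (at s))"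
proof -
  let ?x = "(\<Phi> u $ 1, \<Phi> u $ 2)"
  have x: "?x \<in> D" using immersed(2) assms chartD(1) by blast
  have nz: "(\<lambda>v. d1 r ?x * fst v + d2 r ?x * snd v) \<noteq> (\<lambda>v. 0)"
  proof
    assume "(\<lambda>v. d1 r ?x * fst v + d2 r ?x * snd v) = (\<lambda>v. 0)"
    from fun_cong[OF this, of "(1, 0)"] fun_cong[OF this, of "(0, 1)"]
    show False using dr_nonzero[OF assms] by simp
  qed
  note cont = smooth_fun_continuous_on[OF smooth_fun_d1[OF r_smooth]]
    smooth_fun_continuous_on[OF smooth_fun_d2[OF r_smooth]]
    K_smooth[THEN smooth_fun_continuous_on]
  have "(K0 ?x, K1 ?x) \<noteq> 0" using K_nonzero[OF x] by (simp add: zero_prod_def)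
  moreover have "continuous_on D (\<lambda>x. d1 r x * fst v + d2 r x * snd v)" for v :: "real \<times> real"
    by (intro continuous_intros cont)
  moreover have "continuous_on D (\<lambda>x. (K0 x, K1 x))" by (intro continuous_intros cont)
  moreover have "d1 r x * fst (K0 x, K1 x) + d2 r x * snd (K0 x, K1 x) = 0" if "x \<in> D" for x
    using r_K[OF that] by simp
  ultimately show ?thesis
    using integral_curves_fill_level_sets[OF D_open x r_has_derivative, of "\<lambda>x. (K0 x, K1 x)" thesis]
      nz that by blast
qed

text \<open>Otherwise \<^term>\<open>C\<close>, being a union of level sets of \<^term>\<open>r\<close> inside the box,
  would contain an open set, and so would the null set \<^term>\<open>\<Phi> ` V\<close>.\<close>

lemma r_constant_on_connected:
  assumes u: "u \<in> V"
  obtains B where "open B" "(\<Phi> u $ 1, \<Phi> u $ 2) \<in> B" "B \<subseteq> D"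
    "\<And>X. connected X \<Longrightarrow> X \<subseteq> B \<inter> C \<Longrightarrow> r constant_on X"
proof -
  obtain B where B: "open B" "(\<Phi> u $ 1, \<Phi> u $ 2) \<in> B" "B \<subseteq> D"
    and curves: "\<And>y z. y \<in> B \<Longrightarrow> z \<in> B \<Longrightarrow> r z = r y \<Longrightarrow>
       \<exists>J \<sigma> t. open J \<and> is_interval J \<and> (0::real) \<in> J \<and> t \<in> J \<and> \<sigma> 0 = y \<and> \<sigma> t = z \<and>
       (\<forall>s\<in>J. \<sigma> s \<in> B \<and> (\<sigma> has_vector_derivative (K0 (\<sigma> s), K1 (\<sigma> s))) (at s))"
    by (rule level_box[OF u]) blast
  have cont_r: "continuous_on B r"
    using smooth_fun_continuous_on[OF r_smooth] B(3) continuous_on_subset by blast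
  \<comment> \<open>Within the box, points on one level set are joined by an integral curve of the
    Killing field, and \<open>C\<close> is invariant under that flow.\<close>
  have saturated: "z \<in> C" if y: "y \<in> B" "y \<in> C" and z: "z \<in> B" "r z = r y" for y z
  proof -
    obtain J \<sigma> t where J: "is_interval J" "0 \<in> J" "t \<in> J" and \<sigma>: "\<sigma> 0 = y" "\<sigma> t = z"
      "\<forall>s\<in>J. \<sigma> s \<in> B \<and> (\<sigma> has_vector_derivative (K0 (\<sigma> s), K1 (\<sigma> s))) (at s)"
      using curves[OF y(1) z] by (elim exE conjE)
    have "\<sigma> t \<in> C"
      by (rule C_flow_invariant[OF J]) (use \<sigma> B(3) y in auto)
    then show ?thesis using \<sigma> by simp
  qed
  have S_null: "negligible (\<Phi> ` V)"
    by (rule negligible_differentiable_image_lowdim)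
      (auto intro!: differentiable_at_imp_differentiable_on immersed)
  have "r y = r z" if X: "connected X" "X \<subseteq> B \<inter> C" and yz: "y \<in> X" "z \<in> X" for X y z
  proof (rule ccontr)
    assume "r y \<noteq> r z"
    define a b where "a = min (r y) (r z)" and "b = max (r y) (r z)"
    then have ab: "a < b" "a \<in> r ` X" "b \<in> r ` X"
      using yz \<open>r y \<noteq> r z\<close> by (auto simp: min_def max_def)
    have "connected (r ` X)"
      using X cont_r by (intro connected_continuous_image) (auto intro: continuous_on_subset)
    then have sub: "{a..b} \<subseteq> r ` X" using ab by (simp add: connected_contains_Icc)
    \<comment> \<open>By \<open>sub\<close>, each value of \<open>r\<close> on \<open>W\<close> is
      attained on \<open>X\<close>, hence on \<open>C\<close>. Saturation then puts all of
      \<open>W\<close> into \<open>C\<close>, and rotational invariance puts the open set over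
      \<open>W\<close> into the hypersurface.\<close>
    define W where "W = B \<inter> r -` {a<..<b}"
    have "open W" unfolding W_def using continuous_open_preimage[OF cont_r B(1)] by auto
    then have "open (chartdom W)" by (rule open_chartdom)
    moreover have "chartdom W \<subseteq> \<Phi> ` V"
    proof
      fix p assume p: "p \<in> chartdom W"
      then have xp: "(p $ 1, p $ 2) \<in> W" by (simp add: chartdom_def)
      then have "r (p $ 1, p $ 2) \<in> r ` X" using sub by (auto simp: W_def)
      then obtain y where "y \<in> X" "r (p $ 1, p $ 2) = r y" by blast
      then have "(p $ 1, p $ 2) \<in> C" using saturated[of y] X xp by (auto simp: W_def)
      moreover have "p \<in> U" using p B(3) by (auto simp: chartdom_def W_def)
      ultimately show "p \<in> \<Phi> ` V" by (simp add: mem_S_iff)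
    qed
    moreover have "chartdom W \<noteq> {}"
    proof -
      have "(a + b) / 2 \<in> {a..b}" using ab by auto
      then obtain w where "w \<in> X" "r w = (a + b) / 2" using sub by (metis imageE subsetD)
      then have "w \<in> W" using X ab(1) by (auto simp: W_def)
      then have "(vector [fst w, snd w, pi / 2, 0] :: real^4) \<in> chartdom W"
        by (simp add: chartdom_def)
      then show ?thesis by blast
    qed
    ultimately show False using S_null open_not_negligible negligible_subset by blast
  qed
  then have "r constant_on X" if "connected X" "X \<subseteq> B \<inter> C" for X
    using that unfolding constant_on_def by blast
  then show ?thesis by (rule that[OF B])
qed

text \<open>Near \<open>u\<close> the function \<open>r\<close> is constant along the immersion, so
  \<open>dr\<close> annihilates the image of its derivative. That image has dimension 3 by
  injectivity, and the kernel of the nonzero covector \<open>dr\<close> also has dimension 3, so the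
  inclusion is an equality.\<close>

lemma tangent_space_eq:
  assumes u: "u \<in> V"
  defines "x \<equiv> (\<Phi> u $ 1, \<Phi> u $ 2)"
  shows "tangent_space \<Phi> u = {v. d1 r x * v $ 1 + d2 r x * v $ 2 = 0}"
proof -
  obtain B where B: "open B" "x \<in> B" "B \<subseteq> D"
    and const: "\<And>X. connected X \<Longrightarrow> X \<subseteq> B \<inter> C \<Longrightarrow> r constant_on X"
    unfolding x_def by (rule r_constant_on_connected[OF u]) blast
  have x: "x \<in> D" using B by auto
  let ?\<Phi>' = "frechet_derivative \<Phi> (at u)"
  have \<Phi>': "(\<Phi> has_derivative ?\<Phi>') (at u)"
    using immersed(3)[OF u] frechet_derivative_works by blast
  have lin: "linear ?\<Phi>'" using \<Phi>' has_derivative_linear by blast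
  define \<pi> where "\<pi> = (\<lambda>u. (\<Phi> u $ 1, \<Phi> u $ 2))"
  have cont\<Phi>: "continuous_on V \<Phi>"
    by (intro differentiable_imp_continuous_on differentiable_at_imp_differentiable_on immersed(3))
  have cont\<pi>: "continuous_on V \<pi>" unfolding \<pi>_def by (intro continuous_intros cont\<Phi>)
  have "open (V \<inter> \<pi> -` B)" using continuous_open_preimage[OF cont\<pi> immersed(1) B(1)] .
  moreover have "u \<in> V \<inter> \<pi> -` B" using u B(2) by (simp add: \<pi>_def x_def)
  ultimately obtain \<delta> where \<delta>: "\<delta> > 0" "ball u \<delta> \<subseteq> V \<inter> \<pi> -` B"
    using open_contains_ball by blast
  \<comment> \<open>A ball small enough to project into the box has connected image there, which is
    what local constancy of \<open>r\<close> on \<open>C\<close> requires.\<close>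
  have "connected (\<pi> ` ball u \<delta>)"
    by (rule connected_continuous_image) (use cont\<pi> \<delta> in \<open>auto intro: continuous_on_subset\<close>)
  moreover have "\<pi> ` ball u \<delta> \<subseteq> B \<inter> C"
  proof
    fix y assume "y \<in> \<pi> ` ball u \<delta>"
    then obtain w where "w \<in> V" "\<pi> w \<in> B" "y = \<pi> w" using \<delta>(2) by blast
    then show "y \<in> B \<inter> C" by (simp add: C_def \<pi>_def)
  qed
  ultimately obtain c where c: "\<And>w. w \<in> ball u \<delta> \<Longrightarrow> r (\<pi> w) = c"
    using const unfolding constant_on_def by blast
  have "(lift2 r has_derivative (\<lambda>v. d1 r x * v $ 1 + d2 r x * v $ 2)) (at (\<Phi> u))"
    using has_derivative_lift2[of r "\<Phi> u"] smooth_fun_differentiable[OF r_smooth D_open x]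
    by (simp add: x_def)
  from has_derivative_compose[OF \<Phi>' this]
  have "((\<lambda>w. r (\<pi> w)) has_derivative (\<lambda>h. d1 r x * ?\<Phi>' h $ 1 + d2 r x * ?\<Phi>' h $ 2)) (at u)"
    by (simp add: lift2_def \<pi>_def)
  then have "((\<lambda>w. c) has_derivative (\<lambda>h. d1 r x * ?\<Phi>' h $ 1 + d2 r x * ?\<Phi>' h $ 2)) (at u)"
    by (rule has_derivative_transform_within_open[of _ _ _ _ "ball u \<delta>"]) (use \<delta> c in auto)
  from fun_cong[OF has_derivative_unique[OF this has_derivative_const]]
  have "d1 r x * ?\<Phi>' h $ 1 + d2 r x * ?\<Phi>' h $ 2 = 0" for h .
  then have sub: "tangent_space \<Phi> u \<subseteq> {v. d1 r x * v $ 1 + d2 r x * v $ 2 = 0}"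
    by (auto simp: tangent_space_def)
  define n :: "real^4" where "n = vector [d1 r x, d2 r x, 0, 0]"
  have n: "{v. d1 r x * v $ 1 + d2 r x * v $ 2 = 0} = {v. n \<bullet> v = 0}"
    by (simp add: n_def inner_vec_def sum_4)
  have "n $ 1 \<noteq> 0 \<or> n $ 2 \<noteq> 0" using dr_nonzero[OF u] by (auto simp: n_def x_def)
  then have "n \<noteq> 0" by auto
  then have "dim {v. n \<bullet> v = 0} = 3" by (simp add: dim_hyperplane)
  moreover have "dim (range ?\<Phi>') = 3"
    using dim_image_eq[OF lin, of UNIV] immersed(4)[OF u] by (simp add: inj_on_def)
  ultimately show ?thesis
    using sub unfolding n tangent_space_def
    by (intro subspace_dim_equal) (auto simp: subspace_hyperplane linear_subspace_image[OF lin])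
qed

end

text \<open>The (x^0, x^1) block of the metric cancels the inverse block in \<open>accel_eq\<close>.
  The lowered components are the ones that pair directly with the Killing field.\<close>

lemma (in sss_chart) lower_accel:
  assumes p: "p \<in> U"
  defines "x \<equiv> (p $ 1, p $ 2)"
  shows "g00 x * accel p k 1 + g01 x * accel p k 2 = accel_low1 p k"
    "g01 x * accel p k 1 + g11 x * accel p k 2 = accel_low2 p k"
proof -
  have \<Delta>: "\<Delta> x \<noteq> 0" using \<Delta>_neg[OF chartD(1)[OF p]] by (simp add: x_def)
  have "g00 x * accel p k 1 + g01 x * accel p k 2
      = (g00 x * (g11 x * accel_low1 p k - g01 x * accel_low2 p k) + g01 x * (g00 x * accel_low2 p k - g01 x * accel_low1 p k)) / \<Delta> x"
    by (simp add: accel_eq[OF p, folded x_def] add_divide_distrib)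
  also have "\<dots> = \<Delta> x * accel_low1 p k / \<Delta> x" by (simp add: \<Delta>_def algebra_simps power2_eq_square)
  finally show "g00 x * accel p k 1 + g01 x * accel p k 2 = accel_low1 p k" using \<Delta> by simp
  have "g01 x * accel p k 1 + g11 x * accel p k 2
      = (g01 x * (g11 x * accel_low1 p k - g01 x * accel_low2 p k) + g11 x * (g00 x * accel_low2 p k - g01 x * accel_low1 p k)) / \<Delta> x"
    by (simp add: accel_eq[OF p, folded x_def] add_divide_distrib)
  also have "\<dots> = \<Delta> x * accel_low2 p k / \<Delta> x" by (simp add: \<Delta>_def algebra_simps power2_eq_square)
  finally show "g01 x * accel p k 1 + g11 x * accel p k 2 = accel_low2 p k" using \<Delta> by simp
qed

section \<open>The Killing field along the hypersurface and the two implications\<close>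

context sss_hypersurface
begin

text \<open>The squared norm g(K, K) of the Killing field.\<close>

definition K_sq :: "real \<times> real \<Rightarrow> real" where
  "K_sq x = g00 x * (K0 x)\<^sup>2 + 2 * g01 x * K0 x * K1 x + g11 x * (K1 x)\<^sup>2"

text \<open>The first identity is the (theta, theta) component of the Killing equation. The second
  is its (x^0, x^1) block contracted twice with the field; it is half the derivative of
  \<open>K_sq\<close> along the flow.\<close>

lemma killing_contractions:
  assumes x: "x \<in> D"
  defines "DK f \<equiv> d1 f x * K0 x + d2 f x * K1 x"
  shows "DK gth = 0"
    "(DK g00 * (K0 x)\<^sup>2 + 2 * DK g01 * K0 x * K1 x + DK g11 * (K1 x)\<^sup>2) / 2
      + (g00 x * K0 x + g01 x * K1 x) * DK K0 + (g01 x * K0 x + g11 x * K1 x) * DK K1 = 0"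
proof -
  define p :: "real^4" where "p = vector [fst x, snd x, pi / 2, 0]"
  have p: "p \<in> U" and px: "(p $ 1, p $ 2) = x" using x by (auto simp: p_def chartdom_def)
  have L: "lift2 f p = f x" for f by (simp add: lift2_def px)
  note d = metric_differentiable[OF x, folded px] and
    dK = K_smooth[THEN smooth_fun_differentiable[OF _ D_open x], folded px]
  have vf: "vf2 K0 K1 q $ 1 = lift2 K0 q" "vf2 K0 K1 q $ 2 = lift2 K1 q"
    "vf2 K0 K1 q $ 3 = 0" "vf2 K0 K1 q $ 4 = 0" for q
    by (simp_all add: vf2_def lift2_def)
  note S = sum_4 vf sss_metric_nth L
    d[THEN partial_lift2(1), unfolded px] d[THEN partial_lift2(2), unfolded px]
    dK[THEN partial_lift2(1), unfolded px] dK[THEN partial_lift2(2), unfolded px]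
    dK[THEN partial_lift2(3)] dK[THEN partial_lift2(4)]
  have K: "(\<Sum>k\<in>UNIV. vf2 K0 K1 p $ k * partial k (\<lambda>q. G q $ i $ j) p
        + G p $ k $ j * partial i (\<lambda>q. vf2 K0 K1 q $ k) p
        + G p $ i $ k * partial j (\<lambda>q. vf2 K0 K1 q $ k) p) = 0" for i j
    using K_killing p unfolding killing_field_def by blast
  show "DK gth = 0" using K[of 3 3] by (simp add: S DK_def algebra_simps)
  have 11: "DK g00 + 2 * (g00 x * d1 K0 x + g01 x * d1 K1 x) = 0"
    using K[of 1 1] by (simp add: S DK_def algebra_simps)
  have 12: "DK g01 + g01 x * d1 K0 x + g11 x * d1 K1 x + g00 x * d2 K0 x + g01 x * d2 K1 x = 0"
    using K[of 1 2] by (simp add: S DK_def algebra_simps)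
  have 22: "DK g11 + 2 * (g01 x * d2 K0 x + g11 x * d2 K1 x) = 0"
    using K[of 2 2] by (simp add: S DK_def algebra_simps)
  have e: "DK g00 = - 2 * (g00 x * d1 K0 x + g01 x * d1 K1 x)"
    "DK g01 = - (g01 x * d1 K0 x + g11 x * d1 K1 x + g00 x * d2 K0 x + g01 x * d2 K1 x)"
    "DK g11 = - 2 * (g01 x * d2 K0 x + g11 x * d2 K1 x)"
    using 11 12 22 by linarith+
  show "(DK g00 * (K0 x)\<^sup>2 + 2 * DK g01 * K0 x * K1 x + DK g11 * (K1 x)\<^sup>2) / 2
      + (g00 x * K0 x + g01 x * K1 x) * DK K0 + (g01 x * K0 x + g11 x * K1 x) * DK K1 = 0"
    unfolding e by (simp add: DK_def field_simps power2_eq_square)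
qed

text \<open>The formula is the squared norm of (\<open>d2 r\<close>, \<open>- d1 r\<close>). In a
  timelike tangent vector the angular part contributes nonnegatively, so the rest, a multiple of
  this vector, must be timelike.\<close>

lemma dr_perp_timelike:
  assumes u: "u \<in> V"
  defines "x \<equiv> (\<Phi> u $ 1, \<Phi> u $ 2)"
  shows "g11 x * (d1 r x)\<^sup>2 - 2 * g01 x * d1 r x * d2 r x + g00 x * (d2 r x)\<^sup>2 < 0"
proof -
  have x: "x \<in> D" using immersed(2) u chartD(1) unfolding x_def by blast
  obtain v where v: "v \<in> tangent_space \<Phi> u" "gform G (\<Phi> u) v v < 0"
    using S_timelike u unfolding timelike_hypersurface_def by blast
  have "d1 r x * v $ 1 + d2 r x * v $ 2 = 0" using v(1) tangent_space_eq[OF u] by (simp add: x_def)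
  then obtain \<mu> where \<mu>: "v $ 1 = \<mu> * d2 r x" "v $ 2 = - \<mu> * d1 r x"
    using orthogonal_to_nonzero_2 dr_nonzero[OF u] x_def by metis
  have "gform G (\<Phi> u) v v =
      \<mu>\<^sup>2 * (g11 x * (d1 r x)\<^sup>2 - 2 * g01 x * d1 r x * d2 r x + g00 x * (d2 r x)\<^sup>2)
      + gth x * ((v $ 3)\<^sup>2 + (sin (\<Phi> u $ 3) * v $ 4)\<^sup>2)"
    by (simp add: gform_eq x_def[symmetric] Let_def \<mu> algebra_simps power2_eq_square)
  moreover have "gth x * ((v $ 3)\<^sup>2 + (sin (\<Phi> u $ 3) * v $ 4)\<^sup>2) \<ge> 0"
    using gth_pos[OF x] by simp
  ultimately have "\<mu>\<^sup>2 * (g11 x * (d1 r x)\<^sup>2 - 2 * g01 x * d1 r x * d2 r x + g00 x * (d2 r x)\<^sup>2) < 0"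
    using v(2) by linarith
  then show ?thesis by (simp add: mult_less_0_iff)
qed

text \<open>\<open>dr\<close> annihilates the Killing field, which is therefore a nonzero multiple
  of the timelike vector from \<open>dr_perp_timelike\<close>.\<close>

lemma K_sq_neg:
  assumes u: "u \<in> V"
  shows "K_sq (\<Phi> u $ 1, \<Phi> u $ 2) < 0"
proof -
  let ?x = "(\<Phi> u $ 1, \<Phi> u $ 2)"
  have x: "?x \<in> D" using immersed(2) u chartD(1) by blast
  obtain \<mu> where \<mu>: "K0 ?x = \<mu> * d2 r ?x" "K1 ?x = - \<mu> * d1 r ?x"
    using orthogonal_to_nonzero_2[OF dr_nonzero[OF u] r_K[OF x]] by metis
  then have "\<mu> \<noteq> 0" using K_nonzero[OF x] by auto
  have "K_sq ?x = \<mu>\<^sup>2 * (g11 ?x * (d1 r ?x)\<^sup>2 - 2 * g01 ?x * d1 r ?x * d2 r ?x + g00 ?x * (d2 r ?x)\<^sup>2)"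
    unfolding K_sq_def \<mu> by (simp add: algebra_simps power2_eq_square)
  then show ?thesis using dr_perp_timelike[OF u] \<open>\<mu> \<noteq> 0\<close> by (simp add: mult_pos_neg)
qed

text \<open>One null tangent direction suffices, because the photon condition is equivalent to
  vanishing of the Hessian on any single one.\<close>

lemma photon_surface_imp_photon_condition:
  assumes "photon_surface G U \<Phi> V" and u: "u \<in> V"
  shows "photon_condition G (lift2 r) (lift2 gth) (\<Phi> u)"
proof -
  define x where "x = (\<Phi> u $ 1, \<Phi> u $ 2)"
  have pU: "\<Phi> u \<in> U" using immersed(2) u by blast
  have x: "x \<in> D" using chartD(1)[OF pU] by (simp add: x_def)
  note dr = dr_nonzero[OF u, folded x_def]
  define A where "A = g11 x * (d1 r x)\<^sup>2 - 2 * g01 x * d1 r x * d2 r x + g00 x * (d2 r x)\<^sup>2"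
  have A: "A < 0" using dr_perp_timelike[OF u] by (simp add: A_def x_def)
  have Q: "gth x > 0" using gth_pos[OF x] .
  \<comment> \<open>The third component is chosen to make \<open>k\<close> null; the root is real
    because \<open>A\<close> is negative.\<close>
  define k :: "real^4" where "k = vector [d2 r x, - d1 r x, sqrt (- A / gth x), 0]"
  have kT: "d1 r x * k $ 1 + d2 r x * k $ 2 = 0" by (simp add: k_def)
  have k_tan: "k \<in> tangent_space \<Phi> u" using kT tangent_space_eq[OF u] by (simp add: x_def)
  have "k $ 1 \<noteq> 0 \<or> k $ 2 \<noteq> 0" using dr by (auto simp: k_def)
  then have k0: "k \<noteq> 0" by auto
  have "k $ 3 * k $ 3 = - A / gth x" using A Q by (simp add: k_def divide_nonpos_pos)
  moreover have "gform G (\<Phi> u) k k = A + gth x * (k $ 3 * k $ 3)"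
    by (simp add: gform_eq x_def[symmetric] Let_def k_def A_def algebra_simps power2_eq_square)
  ultimately have null: "gform G (\<Phi> u) k k = 0" using Q by simp
  obtain \<epsilon> \<gamma> where \<epsilon>: "\<epsilon> > 0" and geo: "geodesic G U {-\<epsilon><..<\<epsilon>} \<gamma>" and \<gamma>0: "\<gamma> 0 = \<Phi> u"
    "(\<gamma> has_vector_derivative k) (at 0)" and \<gamma>S: "\<gamma> ` {-\<epsilon><..<\<epsilon>} \<subseteq> \<Phi> ` V"
    using assms(1) u k_tan k0 null unfolding photon_surface_def by blast
  obtain \<gamma>' \<gamma>'' where \<gamma>: "\<And>t. t \<in> {-\<epsilon><..<\<epsilon>} \<Longrightarrow> \<gamma> t \<in> U"
      "\<And>t. t \<in> {-\<epsilon><..<\<epsilon>} \<Longrightarrow> (\<gamma> has_vector_derivative \<gamma>' t) (at t)"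
      "\<And>t. t \<in> {-\<epsilon><..<\<epsilon>} \<Longrightarrow> (\<gamma>' has_vector_derivative \<gamma>'' t) (at t)"
    and eq: "\<And>t m. t \<in> {-\<epsilon><..<\<epsilon>} \<Longrightarrow> \<gamma>'' t $ m + accel (\<gamma> t) (\<gamma>' t) m = 0"
    using geo unfolding geodesic_def accel_def by blast
  have z: "0 \<in> {-\<epsilon><..<\<epsilon>}" using \<epsilon> by simp
  have \<gamma>'0: "\<gamma>' 0 = k" using vector_derivative_unique_at[OF \<gamma>(2)[OF z] \<gamma>0(2)] .
  obtain B where B: "open B" "x \<in> B" "B \<subseteq> D"
    and const: "\<And>X. connected X \<Longrightarrow> X \<subseteq> B \<inter> C \<Longrightarrow> r constant_on X"
    unfolding x_def by (rule r_constant_on_connected[OF u]) blast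
  define \<pi> where "\<pi> = (\<lambda>t. (\<gamma> t $ 1, \<gamma> t $ 2))"
  have "continuous_on {-\<epsilon><..<\<epsilon>} \<gamma>"
    by (intro continuous_at_imp_continuous_on ballI has_vector_derivative_continuous[OF \<gamma>(2)])
  then have cont: "continuous_on {-\<epsilon><..<\<epsilon>} \<pi>" unfolding \<pi>_def by (intro continuous_intros)
  have "open ({-\<epsilon><..<\<epsilon>} \<inter> \<pi> -` B)" using continuous_open_preimage[OF cont _ B(1)] by simp
  moreover have "0 \<in> {-\<epsilon><..<\<epsilon>} \<inter> \<pi> -` B" using z B(2) by (simp add: \<pi>_def \<gamma>0 x_def)
  ultimately obtain \<delta> where \<delta>: "\<delta> > 0" "ball 0 \<delta> \<subseteq> {-\<epsilon><..<\<epsilon>} \<inter> \<pi> -` B"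
    using open_contains_ball by blast
  \<comment> \<open>For short times the geodesic projects into the box around \<open>x\<close>,
    where connectedness makes \<open>r\<close> constant along it.\<close>
  have "connected (\<pi> ` ball 0 \<delta>)"
    by (rule connected_continuous_image) (use cont \<delta> in \<open>auto intro: continuous_on_subset\<close>)
  moreover have "\<pi> ` ball 0 \<delta> \<subseteq> B \<inter> C"
  proof
    fix y assume "y \<in> \<pi> ` ball 0 \<delta>"
    then obtain t where t: "t \<in> {-\<epsilon><..<\<epsilon>}" "\<pi> t \<in> B" "y = \<pi> t" using \<delta>(2) by blast
    then have "\<gamma> t \<in> \<Phi> ` V" using \<gamma>S by blast
    then show "y \<in> B \<inter> C" using t by (simp add: mem_S_iff \<pi>_def)
  qed
  ultimately obtain c where c: "\<And>t. t \<in> ball 0 \<delta> \<Longrightarrow> r (\<pi> t) = c"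
    using const unfolding constant_on_def by blast
  have sub: "t \<in> {-\<epsilon><..<\<epsilon>}" if "t \<in> ball 0 \<delta>" for t using \<delta>(2) that by blast
  have "D2 r x (k $ 1) (k $ 2) + d1 r x * \<gamma>'' 0 $ 1 + d2 r x * \<gamma>'' 0 $ 2 = 0"
    using derivatives_along_level_curve(2)[OF r_smooth open_ball, of 0 0 \<delta> \<gamma> \<gamma>' \<gamma>'' c]
      \<delta>(1) \<gamma> sub c by (simp add: \<gamma>'0 \<gamma>0(1) x_def[symmetric] \<pi>_def)
  moreover have "\<gamma>'' 0 $ m = - accel (\<Phi> u) k m" for m
    using eq[OF z, of m] by (simp add: \<gamma>0 \<gamma>'0)
  ultimately have "hess_quad r (\<Phi> u) k = 0"
    by (simp add: hess_quad_def x_def[symmetric])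
  then show ?thesis
    using photon_condition_iff_hess_quad[OF r_smooth pU _ k0 null] dr kT by (simp add: x_def)
qed

text \<open>The curve is given explicitly by a Killing orbit and a great circle, so the geodesic
  equation only has to be verified, which is done in \<open>geo\<close>. Containment in the
  hypersurface follows from the invariance of \<open>C\<close> under the flow.\<close>

lemma photon_condition_imp_null_geodesic:
  assumes photon: "\<And>u. u \<in> V \<Longrightarrow> photon_condition G (lift2 r) (lift2 gth) (\<Phi> u)"
    and u: "u \<in> V" and k: "k \<in> tangent_space \<Phi> u" "k \<noteq> 0" "gform G (\<Phi> u) k k = 0"
  obtains \<epsilon> \<gamma> where "\<epsilon> > 0" "geodesic G U {-\<epsilon><..<\<epsilon>} \<gamma>" "\<gamma> 0 = \<Phi> u"
    "(\<gamma> has_vector_derivative k) (at 0)" "\<gamma> ` {-\<epsilon><..<\<epsilon>} \<subseteq> \<Phi> ` V"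
proof -
  define p0 where "p0 = \<Phi> u"
  define x0 where "x0 = (p0 $ 1, p0 $ 2)"
  have p0: "p0 \<in> U" using immersed(2) u by (auto simp: p0_def)
  have x0: "x0 \<in> D" using chartD(1)[OF p0] by (simp add: x0_def)
  note dr0 = dr_nonzero[OF u, folded p0_def, folded x0_def]
  obtain \<mu> where \<mu>: "K0 x0 = \<mu> * d2 r x0" "K1 x0 = - \<mu> * d1 r x0"
    using orthogonal_to_nonzero_2[OF dr0 r_K[OF x0]] by metis
  have "\<mu> \<noteq> 0" using \<mu> K_nonzero[OF x0] by auto
  have "d1 r x0 * k $ 1 + d2 r x0 * k $ 2 = 0"
    using k(1) tangent_space_eq[OF u] by (simp add: x0_def p0_def)
  then obtain \<nu> where \<nu>: "k $ 1 = \<nu> * d2 r x0" "k $ 2 = - \<nu> * d1 r x0"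
    using orthogonal_to_nonzero_2[OF dr0] by metis
  \<comment> \<open>\<open>dr\<close> annihilates both the Killing field and the non-angular part of
    \<open>k\<close>, so both are multiples of one vector; \<open>\<alpha>\<close> is their
    ratio.\<close>
  define \<alpha> where "\<alpha> = \<nu> / \<mu>"
  have k12: "k $ 1 = \<alpha> * K0 x0" "k $ 2 = \<alpha> * K1 x0"
    using \<open>\<mu> \<noteq> 0\<close> by (simp_all add: \<alpha>_def \<mu> \<nu>)
  define w where "w = (k $ 3)\<^sup>2 + (sin (p0 $ 3))\<^sup>2 * (k $ 4)\<^sup>2"
  \<comment> \<open>A negative multiple of the square of \<open>\<alpha>\<close> balances a
    nonnegative multiple of \<open>w\<close>, so neither can vanish without the other. Hence
    \<open>\<alpha>\<close> is nonzero and the great circle has nonzero speed.\<close>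
  have null0: "\<alpha>\<^sup>2 * K_sq x0 + gth x0 * w = 0"
    using k(3) by (simp add: p0_def[symmetric] gform_eq x0_def[symmetric] Let_def k12 K_sq_def w_def
        algebra_simps power2_eq_square)
  have K_sq_x0: "K_sq x0 < 0" using K_sq_neg[OF u] by (simp add: x0_def p0_def)
  have \<alpha>0: "\<alpha> \<noteq> 0"
  proof
    assume "\<alpha> = 0"
    then have "w = 0" using null0 gth_pos[OF x0] by simp
    then have "k $ 3 = 0" "k $ 4 = 0" using chartD(2)[OF p0] unfolding w_def
      by (simp_all add: add_nonneg_eq_0_iff)
    then have "k = 0" using \<open>\<alpha> = 0\<close> k12 by (simp add: vec_eq_iff forall_4)
    then show False using k(2) by simp
  qed
  have k34: "(k $ 3, k $ 4) \<noteq> (0, 0)"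
  proof
    assume "(k $ 3, k $ 4) = (0, 0)"
    then have "w = 0" by (simp add: w_def)
    then show False using null0 \<alpha>0 K_sq_x0 by simp
  qed
  have "0 < p0 $ 3" "p0 $ 3 < pi" using p0 by (auto simp: chartdom_def)
  then obtain \<epsilon>1 \<theta> \<phi> \<theta>' \<phi>' where \<epsilon>1: "\<epsilon>1 > 0"
    and init: "\<theta> 0 = p0 $ 3" "\<phi> 0 = p0 $ 4" "\<theta>' 0 = k $ 3" "\<phi>' 0 = k $ 4"
    and \<theta>_range: "\<And>t. \<bar>t\<bar> < \<epsilon>1 \<Longrightarrow> 0 < \<theta> t \<and> \<theta> t < pi"
    and d\<theta>: "\<And>t. \<bar>t\<bar> < \<epsilon>1 \<Longrightarrow> (\<theta> has_real_derivative \<theta>' t) (at t)"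
    and d\<phi>: "\<And>t. \<bar>t\<bar> < \<epsilon>1 \<Longrightarrow> (\<phi> has_real_derivative \<phi>' t) (at t)"
    and d\<theta>': "\<And>t. \<bar>t\<bar> < \<epsilon>1 \<Longrightarrow>
      (\<theta>' has_real_derivative sin (\<theta> t) * cos (\<theta> t) * (\<phi>' t)\<^sup>2) (at t)"
    and d\<phi>': "\<And>t. \<bar>t\<bar> < \<epsilon>1 \<Longrightarrow>
      (\<phi>' has_real_derivative - 2 * cos (\<theta> t) / sin (\<theta> t) * \<theta>' t * \<phi>' t) (at t)"
    and speed: "\<And>t. \<bar>t\<bar> < \<epsilon>1 \<Longrightarrow> (\<theta>' t)\<^sup>2 + (sin (\<theta> t))\<^sup>2 * (\<phi>' t)\<^sup>2 = w"
    unfolding w_def by (rule sphere_geodesic_exists[OF _ _ k34]) blast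
  obtain B where B: "open B" "x0 \<in> B" "B \<subseteq> D"
    and curves: "\<And>y z. y \<in> B \<Longrightarrow> z \<in> B \<Longrightarrow> r z = r y \<Longrightarrow>
       \<exists>J \<sigma> t. open J \<and> is_interval J \<and> (0::real) \<in> J \<and> t \<in> J \<and> \<sigma> 0 = y \<and> \<sigma> t = z \<and>
       (\<forall>s\<in>J. \<sigma> s \<in> B \<and> (\<sigma> has_vector_derivative (K0 (\<sigma> s), K1 (\<sigma> s))) (at s))"
    unfolding x0_def p0_def by (rule level_box[OF u]) blast
  obtain J \<sigma> where J: "open J" "is_interval J" "0 \<in> J" and \<sigma>0: "\<sigma> 0 = x0"
    and \<sigma>: "\<forall>s\<in>J. \<sigma> s \<in> B \<and> (\<sigma> has_vector_derivative (K0 (\<sigma> s), K1 (\<sigma> s))) (at s)"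
    using curves[OF B(2) B(2) refl] by (elim exE conjE)
  have \<sigma>D: "\<sigma> s \<in> D" if "s \<in> J" for s using \<sigma> B(3) that by blast
  have \<sigma>': "(\<sigma> has_vector_derivative (K0 (\<sigma> s), K1 (\<sigma> s))) (at s)" if "s \<in> J" for s
    using \<sigma> that by blast
  have "x0 \<in> C" using u by (auto simp: C_def x0_def p0_def)
  then have \<sigma>C: "\<sigma> s \<in> C" if "s \<in> J" for s
    using C_flow_invariant[OF J(2,3) that \<sigma>D \<sigma>'] by (simp add: \<sigma>0)
  obtain \<delta> where \<delta>: "\<delta> > 0" "ball 0 \<delta> \<subseteq> J" using J open_contains_ball by blast
  \<comment> \<open>Time \<open>t\<close> on the new curve is time \<open>\<alpha> * t\<close> on
    the orbit, which gives the quotient; \<open>\<epsilon>1\<close> keeps the spherical part away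
    from the poles.\<close>
  define \<epsilon> where "\<epsilon> = min \<epsilon>1 (\<delta> / \<bar>\<alpha>\<bar>)"
  define I where "I = {-\<epsilon><..<\<epsilon>}"
  have \<epsilon>: "\<epsilon> > 0" using \<epsilon>1 \<delta>(1) \<alpha>0 by (simp add: \<epsilon>_def)
  have I1: "\<bar>t\<bar> < \<epsilon>1" if "t \<in> I" for t using that by (auto simp: I_def \<epsilon>_def)
  have IJ: "\<alpha> * t \<in> J" if "t \<in> I" for t
  proof -
    have "\<bar>t\<bar> < \<delta> / \<bar>\<alpha>\<bar>" using that by (auto simp: I_def \<epsilon>_def)
    then have "\<bar>\<alpha> * t\<bar> < \<delta>" using \<alpha>0 by (simp add: abs_mult field_simps)
    then show ?thesis using \<delta>(2) by (auto simp: dist_real_def)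
  qed
  have I0: "0 \<in> I" "open I" using \<epsilon> by (auto simp: I_def)
  define x where "x = (\<lambda>t. \<sigma> (\<alpha> * t))"
  define \<gamma> :: "real \<Rightarrow> real^4" where "\<gamma> = (\<lambda>t. vector [fst (x t), snd (x t), \<theta> t, \<phi> t])"
  define \<gamma>' :: "real \<Rightarrow> real^4" where
    "\<gamma>' = (\<lambda>t. vector [\<alpha> * K0 (x t), \<alpha> * K1 (x t), \<theta>' t, \<phi>' t])"
  define DK where "DK = (\<lambda>f y. d1 f y * K0 y + d2 f y * K1 y)"
  define \<gamma>'' :: "real \<Rightarrow> real^4" where
    "\<gamma>'' = (\<lambda>t. vector [\<alpha>\<^sup>2 * DK K0 (x t), \<alpha>\<^sup>2 * DK K1 (x t),
       sin (\<theta> t) * cos (\<theta> t) * (\<phi>' t)\<^sup>2, - 2 * cos (\<theta> t) / sin (\<theta> t) * \<theta>' t * \<phi>' t])"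
  have xD: "x t \<in> D" and xC: "x t \<in> C" if "t \<in> I" for t
    using \<sigma>D[OF IJ[OF that]] \<sigma>C[OF IJ[OF that]] by (auto simp: x_def)
  have \<gamma>x: "(\<gamma> t $ 1, \<gamma> t $ 2) = x t" for t by (simp add: \<gamma>_def)
  have \<gamma>U: "\<gamma> t \<in> U" if "t \<in> I" for t
    using xD[OF that] \<theta>_range[OF I1[OF that]] by (simp add: \<gamma>_def chartdom_def)
  have \<gamma>S: "\<gamma> t \<in> \<Phi> ` V" if "t \<in> I" for t
    using \<gamma>U[OF that] xC[OF that] by (simp add: mem_S_iff \<gamma>x)
  have x0t: "x 0 = x0" by (simp add: x_def \<sigma>0)
  have d\<gamma>: "(\<gamma> has_vector_derivative \<gamma>' t) (at t)" if t: "t \<in> I" for t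
  proof -
    have "((\<lambda>t. \<alpha> * t) has_vector_derivative \<alpha>) (at t)"
      by (auto intro!: derivative_eq_intros)
    from vector_diff_chain_at[OF this \<sigma>'[OF IJ[OF t]]]
    have "(x has_vector_derivative \<alpha> *\<^sub>R (K0 (x t), K1 (x t))) (at t)"
      by (simp add: x_def o_def)
    from has_derivative_fst[OF this[unfolded has_vector_derivative_def]]
      has_derivative_snd[OF this[unfolded has_vector_derivative_def]]
    have "((\<lambda>t. fst (x t)) has_real_derivative \<alpha> * K0 (x t)) (at t)"
      "((\<lambda>t. snd (x t)) has_real_derivative \<alpha> * K1 (x t)) (at t)"
      by (simp_all add: has_real_derivative_iff_has_vector_derivative has_vector_derivative_def)
    then show ?thesis using d\<theta>[OF I1[OF t]] d\<phi>[OF I1[OF t]]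
      by (simp add: has_vector_derivative_componentwise_vec forall_4 \<gamma>_def \<gamma>'_def)
  qed
  have d\<gamma>f: "((\<lambda>t. f (x t)) has_real_derivative \<alpha> * DK f (x t)) (at t)"
    if f: "smooth_fun D f" and t: "t \<in> I" for f t
  proof -
    have "f differentiable (at (\<gamma> t $ 1, \<gamma> t $ 2))"
      using smooth_fun_differentiable[OF f D_open xD[OF t]] by (simp add: \<gamma>x)
    from has_real_derivative_lift2[OF this d\<gamma>[OF t]] show ?thesis
      unfolding \<gamma>x by (simp add: \<gamma>'_def DK_def algebra_simps)
  qed
  have d\<gamma>': "(\<gamma>' has_vector_derivative \<gamma>'' t) (at t)" if t: "t \<in> I" for t
    using DERIV_cmult[OF d\<gamma>f[OF K_smooth(1) t], of \<alpha>] DERIV_cmult[OF d\<gamma>f[OF K_smooth(2) t], of \<alpha>]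
      d\<theta>'[OF I1[OF t]] d\<phi>'[OF I1[OF t]]
    by (simp add: has_vector_derivative_componentwise_vec forall_4 \<gamma>'_def \<gamma>''_def power2_eq_square
        mult.assoc)
  have const: "f t = f 0" if "t \<in> I" "\<And>t. t \<in> I \<Longrightarrow> (f has_real_derivative 0) (at t)"
    for f :: "real \<Rightarrow> real" and t
    using DERIV_isconst3[of "-\<epsilon>" \<epsilon> t 0 f] that \<epsilon> I0 by (simp add: I_def)
  have r_const: "r (x t) = r x0" if "t \<in> I" for t
    using const[OF that, of "\<lambda>t. r (x t)"] d\<gamma>f[OF r_smooth] r_K[OF xD] by (simp add: DK_def x0t)
  have gth_const: "gth (x t) = gth x0" if "t \<in> I" for t
    using const[OF that, of "\<lambda>t. gth (x t)"] d\<gamma>f[OF smooth(4)] killing_contractions(1)[OF xD]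
    by (simp add: DK_def x0t)
  \<comment> \<open>Together with constancy of \<open>gth\<close>, this keeps the curve null and the
    Killing field timelike at later parameters.\<close>
  have K_sq_const: "K_sq (x t) = K_sq x0" if "t \<in> I" for t
  proof -
    have "((\<lambda>t. K_sq (x t)) has_real_derivative 0) (at t)" if t: "t \<in> I" for t
    proof -
      have "((\<lambda>t. K_sq (x t)) has_real_derivative 2 * \<alpha> *
        ((DK g00 (x t) * (K0 (x t))\<^sup>2 + 2 * DK g01 (x t) * K0 (x t) * K1 (x t)
            + DK g11 (x t) * (K1 (x t))\<^sup>2) / 2
          + (g00 (x t) * K0 (x t) + g01 (x t) * K1 (x t)) * DK K0 (x t)
          + (g01 (x t) * K0 (x t) + g11 (x t) * K1 (x t)) * DK K1 (x t))) (at t)"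
        unfolding K_sq_def
        by (rule derivative_eq_intros d\<gamma>f smooth K_smooth t refl)+
          (simp add: field_simps power2_eq_square)
      then show ?thesis using killing_contractions(2)[OF xD[OF t]] by (simp add: DK_def)
    qed
    then show ?thesis using const[OF that, of "\<lambda>t. K_sq (x t)"] by (simp add: x0t)
  qed
  have geo: "\<gamma>'' t $ m + accel (\<gamma> t) (\<gamma>' t) m = 0" if t: "t \<in> I" for t m
  proof -
    define p where "p = \<gamma> t"
    define v where "v = \<gamma>' t"
    define y where "y = x t"
    have pU: "p \<in> U" and yD: "y \<in> D" and py: "(p $ 1, p $ 2) = y" and pS: "p \<in> \<Phi> ` V"
      using \<gamma>U[OF t] xD[OF t] \<gamma>x \<gamma>S[OF t] by (auto simp: p_def y_def)
    obtain u' where u': "u' \<in> V" "p = \<Phi> u'" using pS by blast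
    have dr: "(d1 r y, d2 r y) \<noteq> (0, 0)" using dr_nonzero[OF u'(1)] u'(2) py by simp
    have K_sq_y: "K_sq y < 0" using K_sq_const[OF t] K_sq_x0 by (simp add: y_def)
    have v: "v $ 1 = \<alpha> * K0 y" "v $ 2 = \<alpha> * K1 y" "v $ 3 = \<theta>' t" "v $ 4 = \<phi>' t"
      by (simp_all add: v_def \<gamma>'_def y_def)
    have p34: "p $ 3 = \<theta> t" by (simp add: p_def \<gamma>_def)
    have wt: "(v $ 3)\<^sup>2 + (sin (p $ 3))\<^sup>2 * (v $ 4)\<^sup>2 = w" using speed[OF I1[OF t]] by (simp add: v p34)
    have "gform G p v v = \<alpha>\<^sup>2 * K_sq y + gth y * ((v $ 3)\<^sup>2 + (sin (p $ 3))\<^sup>2 * (v $ 4)\<^sup>2)"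
      by (simp add: gform_eq py Let_def v(1,2) K_sq_def algebra_simps power2_eq_square)
    then have null: "gform G p v v = 0"
      using null0 K_sq_const[OF t] gth_const[OF t] by (simp add: wt y_def)
    have "v $ 1 \<noteq> 0 \<or> v $ 2 \<noteq> 0" using K_nonzero[OF yD] \<alpha>0 by (auto simp: v)
    then have v0: "v \<noteq> 0" by auto
    have drv: "d1 r y * v $ 1 + d2 r y * v $ 2 = 0"
    proof -
      have "d1 r y * v $ 1 + d2 r y * v $ 2 = \<alpha> * (d1 r y * K0 y + d2 r y * K1 y)"
        by (simp add: v algebra_simps)
      then show ?thesis using r_K[OF yD] by simp
    qed
    \<comment> \<open>The curve lies in the hypersurface and stays null, so the photon condition
      applies at each of its points.\<close>
    have "hess_quad r p v = 0"
      using photon_condition_iff_hess_quad[OF r_smooth pU _ v0 null] photon[OF u'(1)] u'(2) dr drv py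
      by simp
    then have H: "D2 r y (v $ 1) (v $ 2) = d1 r y * accel p v 1 + d2 r y * accel p v 2"
      by (simp add: hess_quad_def py)
    have "r (\<gamma> s $ 1, \<gamma> s $ 2) = r x0" if "s \<in> I" for s using r_const[OF that] by (simp add: \<gamma>x)
    from derivatives_along_level_curve(2)[OF r_smooth I0(2) t \<gamma>U d\<gamma> d\<gamma>' this]
    have D: "D2 r y (v $ 1) (v $ 2) + d1 r y * \<gamma>'' t $ 1 + d2 r y * \<gamma>'' t $ 2 = 0"
      by (simp add: \<gamma>x y_def v_def)
    \<comment> \<open>The defect in the non-angular components of the geodesic equation. Comparing
      \<open>H\<close> with \<open>D\<close> shows that \<open>dr\<close> annihilates it.\<close>
    define W1 W2 where "W1 = \<gamma>'' t $ 1 + accel p v 1" and "W2 = \<gamma>'' t $ 2 + accel p v 2"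
    have drW: "d1 r y * W1 + d2 r y * W2 = 0" using H D by (simp add: W1_def W2_def algebra_simps)
    have gthK: "DK gth y = 0" using killing_contractions(1)[OF yD] by (simp add: DK_def)
    note low = lower_accel[OF pU, unfolded py]
    \<comment> \<open>Contraction with the Killing field turns the partial derivatives of the metric
      into derivatives along the flow; the angular term carries the derivative of
      \<open>gth\<close>, which is zero.\<close>
    have "K0 y * accel_low1 p v + K1 y * accel_low2 p v
      = \<alpha>\<^sup>2 * (DK g00 y * (K0 y)\<^sup>2 + 2 * DK g01 y * K0 y * K1 y + DK g11 y * (K1 y)\<^sup>2) / 2
        - DK gth y * w / 2"
      unfolding accel_low1_def accel_low2_def py Let_def wt by (simp add: v DK_def field_simps power2_eq_square)
    then have LK: "K0 y * accel_low1 p v + K1 y * accel_low2 p v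
      = \<alpha>\<^sup>2 * ((DK g00 y * (K0 y)\<^sup>2 + 2 * DK g01 y * K0 y * K1 y + DK g11 y * (K1 y)\<^sup>2) / 2)"
      using gthK by simp
    have "(g00 y * K0 y + g01 y * K1 y) * W1 + (g01 y * K0 y + g11 y * K1 y) * W2
      = (g00 y * K0 y + g01 y * K1 y) * (\<alpha>\<^sup>2 * DK K0 y) + (g01 y * K0 y + g11 y * K1 y) * (\<alpha>\<^sup>2 * DK K1 y)
        + (K0 y * (g00 y * accel p v 1 + g01 y * accel p v 2)
          + K1 y * (g01 y * accel p v 1 + g11 y * accel p v 2))"
      by (simp add: W1_def W2_def \<gamma>''_def y_def algebra_simps)
    also have "\<dots> = \<alpha>\<^sup>2 * ((DK g00 y * (K0 y)\<^sup>2 + 2 * DK g01 y * K0 y * K1 y + DK g11 y * (K1 y)\<^sup>2) / 2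
      + (g00 y * K0 y + g01 y * K1 y) * DK K0 y + (g01 y * K0 y + g11 y * K1 y) * DK K1 y)"
      unfolding low LK by (simp add: algebra_simps)
    also have "\<dots> = 0" using killing_contractions(2)[OF yD] by (simp add: DK_def)
    finally have KW: "(g00 y * K0 y + g01 y * K1 y) * W1 + (g01 y * K0 y + g11 y * K1 y) * W2 = 0" .
    obtain a where a: "K0 y = a * d2 r y" "K1 y = - a * d1 r y"
      using orthogonal_to_nonzero_2[OF dr r_K[OF yD]] by metis
    obtain b where b: "W1 = b * d2 r y" "W2 = - b * d1 r y"
      using orthogonal_to_nonzero_2[OF dr drW] by metis
    \<comment> \<open>The defect and the Killing field are multiples \<open>b\<close> and
      \<open>a\<close> of one vector, so b g(K, K) = a g(K, W) = 0, and g(K, K) < 0 forces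
      \<open>b = 0\<close>.\<close>
    have "b * K_sq y = a * ((g00 y * K0 y + g01 y * K1 y) * W1 + (g01 y * K0 y + g11 y * K1 y) * W2)"
      unfolding K_sq_def a b by (simp add: algebra_simps power2_eq_square)
    then have "b = 0" using KW K_sq_y by simp
    then have W: "W1 = 0" "W2 = 0" using b by auto
    have K3: "d1 gth y * v $ 1 + d2 gth y * v $ 2 = 0"
    proof -
      have "d1 gth y * v $ 1 + d2 gth y * v $ 2 = \<alpha> * DK gth y" by (simp add: v DK_def algebra_simps)
      then show ?thesis using gthK by simp
    qed
    \<comment> \<open>With the drift from \<open>gth\<close> gone, the angular equations are those
      of the unit sphere.\<close>
    have "\<gamma>'' t $ 3 + accel p v 3 = 0" "\<gamma>'' t $ 4 + accel p v 4 = 0"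
      unfolding accel_eq[OF pU] py K3 by (simp_all add: \<gamma>''_def v p34)
    then have "\<forall>m. \<gamma>'' t $ m + accel p v m = 0" using W by (simp add: forall_4 W1_def W2_def)
    then show ?thesis by (simp add: p_def v_def)
  qed
  show ?thesis
  proof
    show "\<epsilon> > 0" by fact
    show "geodesic G U {-\<epsilon><..<\<epsilon>} \<gamma>"
      unfolding geodesic_def I_def[symmetric] accel_def[symmetric]
      by (intro exI[of _ \<gamma>'] exI[of _ \<gamma>''] ballI conjI allI \<gamma>U d\<gamma> d\<gamma>' geo)
    show \<gamma>0: "\<gamma> 0 = \<Phi> u"
      by (simp add: vec_eq_iff forall_4 \<gamma>_def x0t x0_def init p0_def[symmetric])
    have "\<gamma>' 0 = k" by (simp add: vec_eq_iff forall_4 \<gamma>'_def x0t k12 init)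
    then show "(\<gamma> has_vector_derivative k) (at 0)" using d\<gamma>[OF I0(1)] by simp
    show "\<gamma> ` {-\<epsilon><..<\<epsilon>} \<subseteq> \<Phi> ` V" using \<gamma>S by (auto simp: I_def)
  qed
qed

lemma photon_surface_iff_photon_condition:
  "photon_surface G U \<Phi> V \<longleftrightarrow> (\<forall>u\<in>V. photon_condition G (lift2 r) (lift2 gth) (\<Phi> u))"
proof
  assume "photon_surface G U \<Phi> V"
  then show "\<forall>u\<in>V. photon_condition G (lift2 r) (lift2 gth) (\<Phi> u)"
    using photon_surface_imp_photon_condition by blast
next
  assume pc: "\<forall>u\<in>V. photon_condition G (lift2 r) (lift2 gth) (\<Phi> u)"
  have imm: "immersed_hypersurface U \<Phi> V" using S_timelike by (simp add: timelike_hypersurface_def)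
  have ns: "nowhere_spacelike G \<Phi> V"
    unfolding nowhere_spacelike_def
  proof
    fix u assume "u \<in> V"
    then obtain v where v: "v \<in> tangent_space \<Phi> u" "gform G (\<Phi> u) v v < 0"
      using S_timelike unfolding timelike_hypersurface_def by blast
    then have "v \<noteq> 0" by (auto simp: gform_def)
    with v show "\<exists>v\<in>tangent_space \<Phi> u. v \<noteq> 0 \<and> gform G (\<Phi> u) v v \<le> 0" by force
  qed
  have geo: "\<exists>\<epsilon>>0. \<exists>\<gamma>. geodesic G U {-\<epsilon><..<\<epsilon>} \<gamma> \<and> \<gamma> 0 = \<Phi> u \<and>
      (\<gamma> has_vector_derivative k) (at 0) \<and> \<gamma> ` {-\<epsilon><..<\<epsilon>} \<subseteq> \<Phi> ` V"
    if k: "u \<in> V" "k \<in> tangent_space \<Phi> u" "k \<noteq> 0" "gform G (\<Phi> u) k k = 0" for u k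
  proof -
    have "\<And>u. u \<in> V \<Longrightarrow> photon_condition G (lift2 r) (lift2 gth) (\<Phi> u)" using pc by blast
    then obtain \<epsilon> \<gamma> where "\<epsilon> > 0" "geodesic G U {-\<epsilon><..<\<epsilon>} \<gamma>" "\<gamma> 0 = \<Phi> u"
      "(\<gamma> has_vector_derivative k) (at 0)" "\<gamma> ` {-\<epsilon><..<\<epsilon>} \<subseteq> \<Phi> ` V"
      by (rule photon_condition_imp_null_geodesic[OF _ k])
    then show ?thesis by (intro exI[of _ \<epsilon>] exI[of _ \<gamma>] conjI)
  qed
  show "photon_surface G U \<Phi> V"
    unfolding photon_surface_def
  proof (intro conjI ballI impI imm ns)
    fix u k
    assume "u \<in> V" "k \<in> tangent_space \<Phi> u" "k \<noteq> 0 \<and> gform G (\<Phi> u) k k = 0"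
    then show "\<exists>\<epsilon>>0. \<exists>\<gamma>. geodesic G U {-\<epsilon><..<\<epsilon>} \<gamma> \<and> \<gamma> 0 = \<Phi> u \<and>
        (\<gamma> has_vector_derivative k) (at 0) \<and> \<gamma> ` {-\<epsilon><..<\<epsilon>} \<subseteq> \<Phi> ` V"
      using geo by simp
  qed
qed

end

section \<open>The equivalence in terms of the gradient and the Killing field\<close>

theorem theorem4:
  fixes D :: "(real \<times> real) set"
    and g00 g01 g11 gth r K0 K1 :: "real \<times> real \<Rightarrow> real"
    and \<Phi> :: "real^3 \<Rightarrow> real^4" and V :: "(real^3) set"
  defines "U \<equiv> chartdom D"
    and "G \<equiv> sss_metric g00 g01 g11 gth"
    and "K \<equiv> vf2 K0 K1"
  assumes D_open: "open D"
    and smooth: "smooth_fun D g00" "smooth_fun D g01" "smooth_fun D g11" "smooth_fun D gth"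
      "smooth_fun D r"
    and pos: "\<forall>x\<in>D. g00 x > 0 \<and> g01 x > 0 \<and> g11 x > 0 \<and> gth x > 0"
    and lorentzian: "\<forall>x\<in>D. g00 x * g11 x - (g01 x)\<^sup>2 < 0"
    and gth_fun_r: "\<exists>h :: real \<Rightarrow> real. \<forall>x\<in>D. gth x = h (r x)"
    and K_smooth: "smooth_fun D K0" "smooth_fun D K1"
    and K_nonzero: "\<forall>x\<in>D. (K0 x, K1 x) \<noteq> (0, 0)"
    and K_killing: "killing_field G U K"
    and K_hso: "hypersurface_orthogonal G U K"
    and r_invariant: "\<forall>p\<in>U. (\<Sum>k\<in>UNIV. K p $ k * partial k (lift2 r) p) = 0"
    and S_timelike: "timelike_hypersurface G U \<Phi> V"
    and S_so3: "so3_invariant U (\<Phi> ` V)"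
    and S_R: "flow_invariant K U (\<Phi> ` V)"
    and grad_r: "\<forall>u\<in>V. gradient G (lift2 r) (\<Phi> u) \<noteq> 0"
  shows "(so3_invariant U (\<Phi> ` V) \<and> flow_invariant K U (\<Phi> ` V) \<and> photon_surface G U \<Phi> V)
     \<longleftrightarrow> (\<forall>u\<in>V. photon_condition G (lift2 r) (lift2 gth) (\<Phi> u))"
proof -
  have part: "partial 1 (lift2 r) p = d1 r (p $ 1, p $ 2)" "partial 2 (lift2 r) p = d2 r (p $ 1, p $ 2)"
    "partial 3 (lift2 r) p = 0" "partial 4 (lift2 r) p = 0" if "p \<in> U" for p
    using that smooth_fun_differentiable[OF smooth(5) D_open, THEN partial_lift2(1)]
      smooth_fun_differentiable[OF smooth(5) D_open, THEN partial_lift2(2)]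
      smooth_fun_differentiable[OF smooth(5) D_open, THEN partial_lift2(3)]
      smooth_fun_differentiable[OF smooth(5) D_open, THEN partial_lift2(4)]
    by (auto simp: U_def chartdom_def)
  have r_K: "d1 r x * K0 x + d2 r x * K1 x = 0" if "x \<in> D" for x
  proof -
    \<comment> \<open>A point of the chart above \<open>x\<close>; the equator avoids the coordinate
      poles.\<close>
    define p :: "real^4" where "p = vector [fst x, snd x, pi / 2, 0]"
    have "p \<in> U" using that by (simp add: p_def U_def chartdom_def)
    then show ?thesis
      using bspec[OF r_invariant, of p] part[of p] by (simp add: sum_4 K_def vf2_def p_def mult.commute)
  qed
  have dr: "(d1 r (\<Phi> u $ 1, \<Phi> u $ 2), d2 r (\<Phi> u $ 1, \<Phi> u $ 2)) \<noteq> (0, 0)" if "u \<in> V" for u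
  proof
    assume 0: "(d1 r (\<Phi> u $ 1, \<Phi> u $ 2), d2 r (\<Phi> u $ 1, \<Phi> u $ 2)) = (0, 0)"
    have "\<Phi> u \<in> U"
      using S_timelike that unfolding timelike_hypersurface_def immersed_hypersurface_def by blast
    \<comment> \<open>Raising the index of the zero covector gives zero, so a nonzero gradient
      forces a nonzero differential.\<close>
    then have "gradient G (lift2 r) (\<Phi> u) = 0"
      using 0 part[of "\<Phi> u"] by (simp add: gradient_def vec_eq_iff sum_4)
    then show False using grad_r that by blast
  qed
  interpret sss_hypersurface D g00 g01 g11 gth r K0 K1 \<Phi> V
    by unfold_locales
      (use D_open smooth pos lorentzian K_smooth K_nonzero K_killing S_timelike S_so3 S_R r_K dr
       in \<open>auto simp: U_def G_def K_def\<close>)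
  show ?thesis
    using photon_surface_iff_photon_condition S_so3 S_R unfolding U_def G_def K_def by blast
qed

end
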